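(* Let $X=\mathbb C^2\setminus\mathbb R^2$, where $\mathbb R^2\subset\mathbb C^2$ is the standard totally real plane. Then $H^{1,1}_{BC,c}(X)=0$, whereas $H^{1,1}_{A}(X)\neq 0$.
   Context: For a complex manifold $X$, $\mathcal A^{p,q}(X)$ denotes the space of smooth complex $(p,q)$-forms and $\mathcal A^{p,q}_c(X)$ the subspace of compactly supported ones. Define $$H^{1,1}_{BC,c}(X)=\frac{\{\alpha\in\mathcal A^{1,1}_c(X):\partial\alpha=0,\ \bar\partial\alpha=0\}}{\partial\bar\partial\,\mathcal A^{0,0}_c(X)},\qquad H^{1,1}_{A}(X)=\frac{\{\alpha\in\mathcal A^{1,1}(X):\partial\bar\partial\alpha=0\}}{\partial\mathcal A^{0,1}(X)+\bar\partial\mathcal A^{1,0}(X)}.$$ *)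

theory Defs
  imports "HOL-Analysis.Analysis" "HOL-Library.Function_Algebras" "HOL-Library.Set_Algebras"
begin

text \<open>Real \<open>C\<^sup>k\<close> regularity on an open set. By finite dimensionality of the domain it
  suffices to ask that every directional derivative of the (differentiable) function
  is of class \<open>C\<^sup>k\<close>.\<close>

primrec ck_on :: "nat \<Rightarrow> 'a::euclidean_space set \<Rightarrow> ('a \<Rightarrow> 'b::real_normed_vector) \<Rightarrow> bool" where
  "ck_on 0 X f \<longleftrightarrow> continuous_on X f"
| "ck_on (Suc k) X f \<longleftrightarrow>
     (\<forall>x\<in>X. f differentiable (at x)) \<and> (\<forall>v. ck_on k X (\<lambda>x. frechet_derivative f (at x) v))"

definition smooth_on :: "'a::euclidean_space set \<Rightarrow> ('a \<Rightarrow> 'b::real_normed_vector) \<Rightarrow> bool" where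
  "smooth_on X f \<longleftrightarrow> (\<forall>k. ck_on k X f)"

text \<open>The Wirtinger derivatives \<open>\<partial>f/\<partial>z\<^sub>j = (f\<^sub>x - \<i> f\<^sub>y)/2\<close> and
  \<open>\<partial>f/\<partial>(cnj z\<^sub>j) = (f\<^sub>x + \<i> f\<^sub>y)/2\<close>, where \<open>z\<^sub>j = x + \<i> y\<close>.\<close>

definition wirt :: "'n \<Rightarrow> (complex ^ 'n::finite \<Rightarrow> complex) \<Rightarrow> complex ^ 'n \<Rightarrow> complex" where
  "wirt j f z = (frechet_derivative f (at z) (axis j 1)
                 - \<i> * frechet_derivative f (at z) (axis j \<i>)) / 2"

definition wirt_bar :: "'n \<Rightarrow> (complex ^ 'n::finite \<Rightarrow> complex) \<Rightarrow> complex ^ 'n \<Rightarrow> complex" where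
  "wirt_bar j f z = (frechet_derivative f (at z) (axis j 1)
                     + \<i> * frechet_derivative f (at z) (axis j \<i>)) / 2"

text \<open>On an open subset \<open>X\<close> of \<open>\<complex>\<^sup>n\<close> a differential form is
  \<open>\<Sum>I J. \<omega> I J dz\<^sub>I \<and> d(cnj z)\<^sub>J\<close>, with \<open>dz\<^sub>I\<close> the wedge product of the \<open>dz\<^sub>i\<close>, \<open>i \<in> I\<close>, in
  increasing order; it is represented by its coefficients \<open>\<omega> I J\<close>. Coefficients are
  set to \<open>0\<close> outside \<open>X\<close>, so that distinct representatives are distinct forms on \<open>X\<close>.\<close>

type_synonym 'n form = "'n set \<Rightarrow> 'n set \<Rightarrow> complex ^ 'n \<Rightarrow> complex"

definition forms :: "nat \<Rightarrow> nat \<Rightarrow> (complex ^ 'n::finite) set \<Rightarrow> 'n form set" where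
  "forms p q X = {\<omega>. (\<forall>I J. smooth_on X (\<omega> I J)) \<and>
                     (\<forall>I J. card I \<noteq> p \<or> card J \<noteq> q \<longrightarrow> \<omega> I J = 0) \<and>
                     (\<forall>I J. \<forall>z. z \<notin> X \<longrightarrow> \<omega> I J z = 0)}"

text \<open>The closure of the nonvanishing locus is taken relative to \<open>X\<close>.\<close>

definition form_support :: "(complex ^ 'n::finite) set \<Rightarrow> 'n form \<Rightarrow> (complex ^ 'n) set" where
  "form_support X \<omega> = X \<inter> closure {z \<in> X. \<exists>I J. \<omega> I J z \<noteq> 0}"

definition forms_c :: "nat \<Rightarrow> nat \<Rightarrow> (complex ^ 'n::finite) set \<Rightarrow> 'n form set" where
  "forms_c p q X = {\<omega> \<in> forms p q X. compact (form_support X \<omega>)}"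

text \<open>The operators \<open>\<partial>\<close> and \<open>\<partial>\<close>-bar. The signs come from moving \<open>dz\<^sub>i\<close> past the \<open>dz\<^sub>k\<close> with
  \<open>k < i\<close>, respectively \<open>d(cnj z)\<^sub>j\<close> past all of \<open>dz\<^sub>I\<close> and the \<open>d(cnj z)\<^sub>k\<close> with \<open>k < j\<close>.\<close>

definition del :: "(complex ^ 'n::{finite,linorder}) set \<Rightarrow> 'n form \<Rightarrow> 'n form" where
  "del X \<omega> I J z = (if z \<in> X
     then \<Sum>i\<in>I. (-1) ^ card {k \<in> I. k < i} * wirt i (\<omega> (I - {i}) J) z
     else 0)"

definition delbar :: "(complex ^ 'n::{finite,linorder}) set \<Rightarrow> 'n form \<Rightarrow> 'n form" where
  "delbar X \<omega> I J z = (if z \<in> X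
     then \<Sum>j\<in>J. (-1) ^ (card I + card {k \<in> J. k < j}) * wirt_bar j (\<omega> I (J - {j})) z
     else 0)"

text \<open>The quotient of an additive group \<open>Z\<close> by a subgroup \<open>B\<close>, as the set of cosets; its zero
  element is \<open>0 +o B\<close>.\<close>

definition quot :: "'a::plus set \<Rightarrow> 'a set \<Rightarrow> 'a set set" where
  "quot Z B = (\<lambda>\<alpha>. \<alpha> +o B) ` Z"

definition BC_cocycles_c :: "(complex ^ 'n::{finite,linorder}) set \<Rightarrow> 'n form set" where
  "BC_cocycles_c X = {\<alpha> \<in> forms_c 1 1 X. del X \<alpha> = 0 \<and> delbar X \<alpha> = 0}"

definition BC_coboundaries_c :: "(complex ^ 'n::{finite,linorder}) set \<Rightarrow> 'n form set" where
  "BC_coboundaries_c X = (\<lambda>f. del X (delbar X f)) ` forms_c 0 0 X"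

definition H11_BC_c :: "(complex ^ 'n::{finite,linorder}) set \<Rightarrow> 'n form set set" where
  "H11_BC_c X = quot (BC_cocycles_c X) (BC_coboundaries_c X)"

definition A_cocycles :: "(complex ^ 'n::{finite,linorder}) set \<Rightarrow> 'n form set" where
  "A_cocycles X = {\<alpha> \<in> forms 1 1 X. del X (delbar X \<alpha>) = 0}"

definition A_coboundaries :: "(complex ^ 'n::{finite,linorder}) set \<Rightarrow> 'n form set" where
  "A_coboundaries X = del X ` forms 0 1 X + delbar X ` forms 1 0 X"

definition H11_A :: "(complex ^ 'n::{finite,linorder}) set \<Rightarrow> 'n form set set" where
  "H11_A X = quot (A_cocycles X) (A_coboundaries X)"

definition real_plane :: "(complex ^ 2) set" where
  "real_plane = {z. \<forall>i. z $ i \<in> \<real>}"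

end

theory Submission
  imports Defs "HOL-Complex_Analysis.Conformal_Mappings"
begin

text \<open>
  Let \<open>X\<close> be the complement of the real plane in \<open>\<complex>\<^sup>2\<close>. Both halves reduce to function theory of one
  variable on suitable holomorphic curves.

  Vanishing of \<open>H\<^sub>B\<^sub>C\<^sub>,\<^sub>c\<close>. A closed \<open>(1,1)\<close>-form with compact support in \<open>X\<close> extends by zero to
  \<open>\<complex>\<^sup>2\<close>. There the Cauchy transform in \<open>z\<^sub>1\<close> solves the \<open>\<partial>\<close>-bar equation with compact support
  (\<open>dbar_compact_support_solution\<close>), and solving it twice, the second time after conjugation,
  yields a potential \<open>f\<close> with compact support in \<open>\<complex>\<^sup>2\<close>
  (\<open>ddbar_compact_support_solution\<close>). A tube around the real plane is free of the
  support of the form, connected, and unbounded; on it the \<open>\<partial>f/\<partial>z\<^sub>i\<close> are holomorphic and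
  vanish far out, so they vanish, and then \<open>f\<close> is antiholomorphic and vanishes as well.
  Hence \<open>f\<close> has compact support already in \<open>X\<close>.

  Nonvanishing of \<open>H\<^sub>A\<close>. By the first half no pairing with closed compactly supported forms can
  detect a class; the obstruction is the class of \<open>\<partial>\<alpha>\<close> in Dolbeault cohomology. Take
  \<open>\<alpha> = dz\<^sub>2 \<and> \<theta>\<close> with \<open>\<theta>\<close> the Bochner-Martinelli kernel with pole at the origin, a point of the
  real plane. If \<open>\<alpha>\<close> were a coboundary, the \<open>\<partial>/\<partial>z\<^sub>1\<close>-derivative of \<open>\<theta>\<close> would be \<open>\<partial>\<close>-bar of a
  function \<open>w\<close> on \<open>X\<close>. Correcting \<open>z\<^sub>1\<^sup>2 w\<close> by an explicit function, smooth off the origin, gives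
  a holomorphic function \<open>P\<close> on \<open>X\<close> with \<open>P (0, z\<^sub>2) = 1 / z\<^sub>2\<close>. The parabolas
  \<open>z\<^sub>2 = \<i> (t + z\<^sub>1\<^sup>2)\<close> with \<open>t > 0\<close> lie in \<open>X\<close>, and their circles \<open>|z\<^sub>1| = 1\<close> stay in a
  compact subset of \<open>X\<close> as \<open>t\<close> tends to \<open>0\<close>, so the maximum principle bounds
  \<open>1 / t\<close>, a contradiction (\<open>d1_bm_coeff_not_dbar_exact\<close>).
\<close>

section \<open>Smooth functions\<close>

lemma frechet_derivative_eqI:
  "(f has_derivative f') (at x) \<Longrightarrow> frechet_derivative f (at x) = f'"
  using frechet_derivative_at by metis

lemma ck_on_differentiable: "ck_on (Suc k) X f \<Longrightarrow> x \<in> X \<Longrightarrow> f differentiable (at x)"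
  by simp

lemma ck_on_Suc_D: "ck_on (Suc k) X f \<Longrightarrow> ck_on k X f"
proof (induction k arbitrary: f)
  case 0
  then show ?case
    by (auto intro!: continuous_at_imp_continuous_on differentiable_imp_continuous_within)
next
  case (Suc k)
  have "ck_on k X (\<lambda>x. frechet_derivative f (at x) v)" for v
    using Suc.prems by (intro Suc.IH) (simp del: ck_on.simps add: ck_on.simps(2)[of "Suc k" X f])
  then show ?case using Suc.prems by simp
qed

lemma ck_on_subset: "ck_on k X f \<Longrightarrow> Y \<subseteq> X \<Longrightarrow> ck_on k Y f"
  by (induction k arbitrary: f) (auto intro: continuous_on_subset)

lemma ck_on_cong:
  assumes "open X" "\<And>x. x \<in> X \<Longrightarrow> f x = g x" "ck_on k X f"
  shows "ck_on k X g"
  using assms(2,3)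
proof (induction k arbitrary: f g)
  case 0
  then show ?case by (simp cong: continuous_on_cong)
next
  case (Suc k)
  have d: "(g has_derivative frechet_derivative f (at x)) (at x)" if "x \<in> X" for x
    using Suc.prems that \<open>open X\<close>
    by (auto simp: frechet_derivative_works intro!: has_derivative_transform_within_open[of f _ x UNIV X g, simplified])
  have "ck_on k X (\<lambda>x. frechet_derivative g (at x) v)" for v
  proof (rule Suc.IH)
    show "ck_on k X (\<lambda>x. frechet_derivative f (at x) v)" using Suc.prems by simp
  qed (simp add: frechet_derivative_eqI[OF d])
  then show ?case using d by (auto simp: differentiable_def)
qed

lemma ck_on_open_Un:
  assumes "open X" "open Y" "ck_on k X f" "ck_on k Y f"
  shows "ck_on k (X \<union> Y) f"
  using assms(3,4)
  by (induction k arbitrary: f) (auto intro: continuous_on_open_Un assms)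

lemma ck_on_const: "ck_on k X (\<lambda>x. c)"
  by (induction k arbitrary: c) auto

lemma ck_on_add:
  assumes "open X" "ck_on k X f" "ck_on k X g"
  shows "ck_on k X (\<lambda>x. f x + g x)"
  using assms(2,3)
proof (induction k arbitrary: f g)
  case (Suc k)
  have d: "((\<lambda>x. f x + g x) has_derivative
      (\<lambda>v. frechet_derivative f (at x) v + frechet_derivative g (at x) v)) (at x)" if "x \<in> X" for x
    using Suc.prems that by (intro has_derivative_add) (auto simp: frechet_derivative_works)
  have "ck_on k X (\<lambda>x. frechet_derivative f (at x) v + frechet_derivative g (at x) v)" for v
    using Suc.prems by (intro Suc.IH) auto
  then have "ck_on k X (\<lambda>x. frechet_derivative (\<lambda>x. f x + g x) (at x) v)" for v
    by (rule ck_on_cong[OF \<open>open X\<close>, rotated]) (simp add: frechet_derivative_eqI[OF d])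
  then show ?case using d by (auto simp: differentiable_def)
qed (auto intro: continuous_intros)

lemma ck_on_bounded_bilinear:
  assumes "bounded_bilinear m" "open X" "ck_on k X f" "ck_on k X g"
  shows "ck_on k X (\<lambda>x. m (f x) (g x))"
  using assms(3,4)
proof (induction k arbitrary: f g)
  case 0
  then show ?case using bounded_bilinear.continuous_on[OF assms(1)] by auto
next
  case (Suc k)
  have d: "((\<lambda>x. m (f x) (g x)) has_derivative
      (\<lambda>v. m (f x) (frechet_derivative g (at x) v) + m (frechet_derivative f (at x) v) (g x))) (at x)"
      if "x \<in> X" for x
    using Suc.prems that
    by (intro bounded_bilinear.FDERIV[OF assms(1)]) (auto simp: frechet_derivative_works)
  have "ck_on k X (\<lambda>x. m (f x) (frechet_derivative g (at x) v) + m (frechet_derivative f (at x) v) (g x))" for v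
    using Suc.prems ck_on_Suc_D[OF Suc.prems(1)] ck_on_Suc_D[OF Suc.prems(2)]
    by (intro ck_on_add \<open>open X\<close> Suc.IH) auto
  then have "ck_on k X (\<lambda>x. frechet_derivative (\<lambda>x. m (f x) (g x)) (at x) v)" for v
    by (rule ck_on_cong[OF \<open>open X\<close>, rotated]) (simp add: frechet_derivative_eqI[OF d])
  then show ?case using d by (auto simp: differentiable_def)
qed

lemma ck_on_linear:
  assumes "bounded_linear h" "open X" "ck_on k X f"
  shows "ck_on k X (\<lambda>x. h (f x))"
  using assms(3)
proof (induction k arbitrary: f)
  case 0
  then show ?case using bounded_linear.continuous_on[OF assms(1)] by auto
next
  case (Suc k)
  have d: "((\<lambda>x. h (f x)) has_derivative (\<lambda>v. h (frechet_derivative f (at x) v))) (at x)"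
      if "x \<in> X" for x
    using Suc.prems that
    by (intro bounded_linear.has_derivative[OF assms(1)]) (auto simp: frechet_derivative_works)
  have "ck_on k X (\<lambda>x. h (frechet_derivative f (at x) v))" for v
    using Suc.prems by (intro Suc.IH) auto
  then have "ck_on k X (\<lambda>x. frechet_derivative (\<lambda>x. h (f x)) (at x) v)" for v
    by (rule ck_on_cong[OF \<open>open X\<close>, rotated]) (simp add: frechet_derivative_eqI[OF d])
  then show ?case using d by (auto simp: differentiable_def)
qed

lemma ck_on_linear_map:
  assumes "bounded_linear h"
  shows "ck_on k X h"
proof (cases k)
  case 0
  then show ?thesis using bounded_linear.continuous_on[OF assms continuous_on_id] by simp
next
  case (Suc m)
  have "frechet_derivative h (at x) = h" for x
    by (rule frechet_derivative_eqI[OF bounded_linear_imp_has_derivative[OF assms]])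
  then show ?thesis
    using Suc bounded_linear_imp_differentiable[OF assms] by (auto simp: ck_on_const)
qed

lemma ck_on_inverse:
  fixes f :: "'a::euclidean_space \<Rightarrow> 'b::real_normed_field"
  assumes "open X" "ck_on k X f" "\<And>x. x \<in> X \<Longrightarrow> f x \<noteq> 0"
  shows "ck_on k X (\<lambda>x. inverse (f x))"
  using assms(2,3)
proof (induction k arbitrary: f)
  case 0
  then show ?case by (auto intro: continuous_intros)
next
  case (Suc k)
  have d: "((\<lambda>x. inverse (f x)) has_derivative
      (\<lambda>v. - (inverse (f x) * frechet_derivative f (at x) v * inverse (f x)))) (at x)"
      if "x \<in> X" for x
    using Suc.prems that
    by (intro Deriv.has_derivative_inverse) (auto simp: frechet_derivative_works)
  have ck: "ck_on k X (\<lambda>x. - (inverse (f x) * frechet_derivative f (at x) v * inverse (f x)))" for v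
    using Suc.prems ck_on_Suc_D[OF Suc.prems(1)]
    by (intro ck_on_linear[OF bounded_linear_minus[OF bounded_linear_ident]]
        ck_on_bounded_bilinear[OF bounded_bilinear_mult] \<open>open X\<close> Suc.IH) auto
  have "ck_on k X (\<lambda>x. frechet_derivative (\<lambda>x. inverse (f x)) (at x) v)" for v
    by (rule ck_on_cong[OF \<open>open X\<close> _ ck[of v]]) (simp add: frechet_derivative_eqI[OF d])
  then show ?case using d by (auto simp: differentiable_def)
qed

lemma smooth_on_differentiable: "smooth_on X f \<Longrightarrow> x \<in> X \<Longrightarrow> f differentiable (at x)"
  unfolding smooth_on_def using ck_on_differentiable by blast

lemma smooth_on_has_derivative:
  "smooth_on X f \<Longrightarrow> x \<in> X \<Longrightarrow> (f has_derivative frechet_derivative f (at x)) (at x)"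
  using smooth_on_differentiable frechet_derivative_works by blast

lemma smooth_on_continuous_on: "smooth_on X f \<Longrightarrow> continuous_on X f"
  unfolding smooth_on_def using ck_on.simps(1) by blast

lemma smooth_on_frechet: "smooth_on X f \<Longrightarrow> smooth_on X (\<lambda>x. frechet_derivative f (at x) v)"
  unfolding smooth_on_def using ck_on.simps(2) by blast

lemma smooth_on_subset: "smooth_on X f \<Longrightarrow> Y \<subseteq> X \<Longrightarrow> smooth_on Y f"
  unfolding smooth_on_def using ck_on_subset by blast

lemma smooth_on_cong:
  "open X \<Longrightarrow> (\<And>x. x \<in> X \<Longrightarrow> f x = g x) \<Longrightarrow> smooth_on X f \<Longrightarrow> smooth_on X g"
  unfolding smooth_on_def using ck_on_cong by blast

lemma smooth_on_open_Un:
  "open X \<Longrightarrow> open Y \<Longrightarrow> smooth_on X f \<Longrightarrow> smooth_on Y f \<Longrightarrow> smooth_on (X \<union> Y) f"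
  unfolding smooth_on_def using ck_on_open_Un by blast

lemma smooth_on_const: "smooth_on X (\<lambda>x. c)"
  unfolding smooth_on_def using ck_on_const by blast

lemma smooth_on_linear_map: "bounded_linear h \<Longrightarrow> smooth_on X h"
  unfolding smooth_on_def using ck_on_linear_map by blast

lemma smooth_on_linear: "bounded_linear h \<Longrightarrow> open X \<Longrightarrow> smooth_on X f \<Longrightarrow> smooth_on X (\<lambda>x. h (f x))"
  unfolding smooth_on_def using ck_on_linear by blast

lemma smooth_on_add:
  "open X \<Longrightarrow> smooth_on X f \<Longrightarrow> smooth_on X g \<Longrightarrow> smooth_on X (\<lambda>x. f x + g x)"
  unfolding smooth_on_def using ck_on_add by blast

lemma smooth_on_mult:
  fixes f g :: "'a::euclidean_space \<Rightarrow> 'b::real_normed_algebra"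
  shows "open X \<Longrightarrow> smooth_on X f \<Longrightarrow> smooth_on X g \<Longrightarrow> smooth_on X (\<lambda>x. f x * g x)"
  unfolding smooth_on_def using ck_on_bounded_bilinear[OF bounded_bilinear_mult] by blast

lemma smooth_on_minus: "open X \<Longrightarrow> smooth_on X f \<Longrightarrow> smooth_on X (\<lambda>x. - f x)"
  using smooth_on_linear[OF bounded_linear_minus[OF bounded_linear_ident]] .

lemma smooth_on_diff:
  "open X \<Longrightarrow> smooth_on X f \<Longrightarrow> smooth_on X g \<Longrightarrow> smooth_on X (\<lambda>x. f x - g x)"
  using smooth_on_add[of X f "\<lambda>x. - g x"] smooth_on_minus[of X g] by simp

lemma smooth_on_inverse:
  fixes f :: "'a::euclidean_space \<Rightarrow> 'b::real_normed_field"
  shows "open X \<Longrightarrow> smooth_on X f \<Longrightarrow> (\<And>x. x \<in> X \<Longrightarrow> f x \<noteq> 0) \<Longrightarrow> smooth_on X (\<lambda>x. inverse (f x))"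
  unfolding smooth_on_def using ck_on_inverse by blast

lemma smooth_on_divide:
  fixes f g :: "'a::euclidean_space \<Rightarrow> 'b::real_normed_field"
  assumes "open X" "smooth_on X f" "smooth_on X g" "\<And>x. x \<in> X \<Longrightarrow> g x \<noteq> 0"
  shows "smooth_on X (\<lambda>x. f x / g x)"
  unfolding divide_inverse using assms by (intro smooth_on_mult smooth_on_inverse)

lemma smooth_on_cnj: "open X \<Longrightarrow> smooth_on X f \<Longrightarrow> smooth_on X (\<lambda>x. cnj (f x))"
  by (rule smooth_on_linear[OF bounded_linear_cnj])

lemma smooth_on_nth: "smooth_on X (\<lambda>z::complex^'n. z $ i)"
  by (rule smooth_on_linear_map[OF bounded_linear_vec_nth])

lemmas smooth_on_intros = smooth_on_const smooth_on_nth smooth_on_add smooth_on_diff smooth_on_minus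
  smooth_on_mult smooth_on_divide smooth_on_inverse smooth_on_cnj

lemma smooth_on_along_curve:
  assumes "smooth_on X g" "q s \<in> X" "(q has_vector_derivative w) (at s within S)"
  shows "((\<lambda>s. g (q s)) has_vector_derivative frechet_derivative g (at (q s)) w) (at s within S)"
  using has_derivative_in_compose[OF assms(3)[unfolded has_vector_derivative_def]
      has_derivative_at_withinI[OF smooth_on_has_derivative[OF assms(1,2)]]]
    linear_simps(5)[OF has_derivative_bounded_linear[OF smooth_on_has_derivative[OF assms(1,2)]]]
  by (simp add: has_vector_derivative_def)

text \<open>Parameter integrals are differentiated through their Frechet derivative as an operator-valued map,
  whereas smoothness is defined by directional derivatives; in finite dimension the latter
  determine continuity of the former.\<close>

lemma smooth_on_continuous_blinfun:
  assumes "smooth_on X f"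
  shows "continuous_on X (\<lambda>x. Blinfun (frechet_derivative f (at x)))"
proof -
  have "blinfun_apply (Blinfun (frechet_derivative f (at x))) v = frechet_derivative f (at x) v"
    if "x \<in> X" for x v
    using smooth_on_has_derivative[OF assms that]
    by (simp add: bounded_linear_Blinfun_apply has_derivative_bounded_linear)
  then have "continuous_on X (\<lambda>x. blinfun_apply (Blinfun (frechet_derivative f (at x))) v)" for v
    using smooth_on_continuous_on[OF smooth_on_frechet[OF assms]] by (simp cong: continuous_on_cong)
  then show ?thesis
    unfolding continuous_on_def by (auto intro!: tendsto_componentwise1)
qed

text \<open>Symmetry of second derivatives. Write \<open>p s t = x + s u + t v\<close>. By the fundamental theorem of calculus
  \<open>f (p s t) - f (p s 0)\<close> is the integral over \<open>[0, t]\<close> of the \<open>v\<close>-derivative. Differentiating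
  under that integral in \<open>s\<close>, and then the result in \<open>t\<close> at the lower end point, turns the
  \<open>u\<close>-derivative of the \<open>v\<close>-derivative into the \<open>v\<close>-derivative of the \<open>u\<close>-derivative.\<close>

lemma frechet_derivative_commute:
  fixes f :: "'a::euclidean_space \<Rightarrow> 'b::banach"
  assumes "open X" "smooth_on X f" "x \<in> X"
  shows "frechet_derivative (\<lambda>y. frechet_derivative f (at y) u) (at x) v
       = frechet_derivative (\<lambda>y. frechet_derivative f (at y) v) (at x) u"
proof -
  obtain r where r: "r > 0" "ball x r \<subseteq> X" using assms openE by blast
  define e where "e = r / (2 * (1 + norm u + norm v))"
  have e: "e > 0" using r by (simp add: e_def add_pos_nonneg)
  define p where "p s t = x + s *\<^sub>R u + t *\<^sub>R v" for s t
  have inX: "p s t \<in> X" if "\<bar>s\<bar> \<le> e" "\<bar>t\<bar> \<le> e" for s t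
  proof -
    have "norm (s *\<^sub>R u + t *\<^sub>R v) \<le> e * norm u + e * norm v"
      using that by (intro norm_triangle_le add_mono) (auto intro: mult_right_mono)
    also have "\<dots> < e * (2 * (1 + norm u + norm v))"
      unfolding distrib_left[symmetric] using e
      by (intro mult_strict_left_mono) (auto intro!: add_nonneg_pos)
    also have "\<dots> = r" using e_def by (smt (verit) norm_ge_zero nonzero_divide_eq_eq)
    finally have "p s t \<in> ball x r"
      by (simp add: p_def dist_norm norm_minus_commute algebra_simps)
    then show ?thesis using r by blast
  qed
  define A where "A s t = frechet_derivative f (at (p s t)) v" for s t
  define B where "B s t = frechet_derivative (\<lambda>y. frechet_derivative f (at y) v) (at (p s t)) u" for s t
  have contp: "continuous_on S (\<lambda>z. p (a z) (b z))" if "continuous_on S a" "continuous_on S b" for S a b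
    unfolding p_def by (intro continuous_intros that)
  have contA: "continuous_on {0..t} (A s)" if "\<bar>s\<bar> \<le> e" "t \<le> e" for s t
    unfolding A_def
    by (rule continuous_on_compose2[OF smooth_on_continuous_on[OF smooth_on_frechet[OF assms(2)]] contp])
       (use that in \<open>auto intro!: continuous_intros inX\<close>)
  have contB: "continuous_on ({-e..e} \<times> {0..t}) (\<lambda>(s,t). B s t)" if "t \<le> e" for t
    unfolding B_def case_prod_beta
    by (rule continuous_on_compose2[OF smooth_on_continuous_on[OF smooth_on_frechet[OF smooth_on_frechet[OF assms(2)]]] contp])
       (use that in \<open>auto intro!: continuous_intros inX\<close>)
  have ps: "((\<lambda>s. p s t) has_vector_derivative u) (at s within S)"
       and pt: "((\<lambda>t. p s t) has_vector_derivative v) (at t within S)" for s t S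
    unfolding p_def by (auto intro!: derivative_eq_intros)
  note chain = smooth_on_along_curve[where X = X]
  have h: "frechet_derivative f (at (p 0 t)) u - frechet_derivative f (at (p 0 0)) u
            = integral {0..t} (B 0)" if t: "0 \<le> t" "t \<le> e" for t
  proof -
    have ftc: "(A s has_integral (f (p s t) - f (p s 0))) {0..t}" if "\<bar>s\<bar> \<le> e" for s
      unfolding A_def
      by (rule fundamental_theorem_of_calculus) (use t that in \<open>auto intro!: chain assms inX pt\<close>)
    have "((\<lambda>s. integral (cbox 0 t) (A s)) has_vector_derivative integral (cbox 0 t) (B 0)) (at 0 within {-e..e})"
    proof (rule leibniz_rule_vector_derivative)
      show "((\<lambda>s. A s \<tau>) has_vector_derivative B s \<tau>) (at s within {-e..e})"
        if "s \<in> {-e..e}" "\<tau> \<in> cbox 0 t" for s \<tau>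
        unfolding A_def B_def using that t
        by (auto intro!: chain smooth_on_frechet assms inX ps)
    qed (use e t contA contB in \<open>auto intro!: integrable_continuous_real\<close>)
    then have "((\<lambda>s. integral {0..t} (A s)) has_vector_derivative integral {0..t} (B 0)) (at 0 within {-e..e})"
      by (simp add: cbox_interval)
    then have 1: "((\<lambda>s. f (p s t) - f (p s 0)) has_vector_derivative integral {0..t} (B 0)) (at 0 within {-e..e})"
      by (rule has_vector_derivative_transform[rotated 2]) (use e integral_unique[OF ftc] in auto)
    have 2: "((\<lambda>s. f (p s t) - f (p s 0)) has_vector_derivative
       frechet_derivative f (at (p 0 t)) u - frechet_derivative f (at (p 0 0)) u) (at 0 within {-e..e})"
      using e t by (intro has_vector_derivative_diff chain assms inX ps) auto
    show ?thesis
      using vector_derivative_unique_within[OF _ 2 1] e by (simp add: at_within_Icc_at)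
  qed
  have "((\<lambda>t. integral {0..t} (B 0)) has_vector_derivative B 0 0) (at 0 within {0..e})"
    using e contB[of e]
    by (intro integral_has_vector_derivative)
       (auto intro!: continuous_on_compose2[OF contB[of e], of "{0..e}" "\<lambda>t. (0,t)", simplified] continuous_intros)
  then have 1: "((\<lambda>t. frechet_derivative f (at (p 0 t)) u - frechet_derivative f (at (p 0 0)) u)
      has_vector_derivative B 0 0) (at 0 within {0..e})"
    by (rule has_vector_derivative_transform[rotated 2]) (use e h in auto)
  have 2: "((\<lambda>t. frechet_derivative f (at (p 0 t)) u - frechet_derivative f (at (p 0 0)) u)
      has_vector_derivative frechet_derivative (\<lambda>y. frechet_derivative f (at y) u) (at (p 0 0)) v - 0)
       (at 0 within {0..e})"
    using e by (intro has_vector_derivative_diff has_vector_derivative_const chain[of "\<lambda>y. frechet_derivative f (at y) u"]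
        smooth_on_frechet assms inX pt) auto
  have "frechet_derivative (\<lambda>y. frechet_derivative f (at y) u) (at (p 0 0)) v - 0 = B 0 0"
    using vector_derivative_unique_within[OF _ 2 1] e by (simp add: at_within_Icc_at_right)
  then show ?thesis by (simp add: B_def p_def)
qed

section \<open>Wirtinger derivatives and forms in two variables\<close>

text \<open>The two Wirtinger operators are the cases \<open>c = -\<i>\<close> and \<open>c = \<i>\<close>, so each rule below
  needs only one proof.\<close>

definition wirt_gen :: "complex \<Rightarrow> 'n \<Rightarrow> (complex ^ 'n::finite \<Rightarrow> complex) \<Rightarrow> complex ^ 'n \<Rightarrow> complex" where
  "wirt_gen c j f z = (frechet_derivative f (at z) (axis j 1) + c * frechet_derivative f (at z) (axis j \<i>)) / 2"

lemma wirt_eq_gen: "wirt = wirt_gen (-\<i>)"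
  by (intro ext) (simp add: wirt_def wirt_gen_def)

lemma wirt_bar_eq_gen: "wirt_bar = wirt_gen \<i>"
  by (intro ext) (simp add: wirt_bar_def wirt_gen_def)

lemma smooth_on_wirt_gen:
  assumes "open X" "smooth_on X f"
  shows "smooth_on X (wirt_gen c j f)"
  unfolding wirt_gen_def[abs_def]
  by (intro smooth_on_intros smooth_on_frechet assms) auto

lemma smooth_on_wirt: "open X \<Longrightarrow> smooth_on X f \<Longrightarrow> smooth_on X (wirt j f)"
  unfolding wirt_eq_gen by (rule smooth_on_wirt_gen)

lemma smooth_on_wirt_bar: "open X \<Longrightarrow> smooth_on X f \<Longrightarrow> smooth_on X (wirt_bar j f)"
  unfolding wirt_bar_eq_gen by (rule smooth_on_wirt_gen)

lemma wirt_gen_cong: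
  assumes "open X" "z \<in> X" "\<And>x. x \<in> X \<Longrightarrow> f x = g x"
  shows "wirt_gen c j f z = wirt_gen c j g z"
proof -
  have "(f has_derivative F) (at z) \<longleftrightarrow> (g has_derivative F) (at z)" for F
    using has_derivative_transform_within_open[of f F z UNIV X g]
      has_derivative_transform_within_open[of g F z UNIV X f] assms by auto
  then have "frechet_derivative f (at z) = frechet_derivative g (at z)"
    unfolding frechet_derivative_def by simp
  then show ?thesis by (simp add: wirt_gen_def)
qed

lemma wirt_cong: "open X \<Longrightarrow> z \<in> X \<Longrightarrow> (\<And>x. x \<in> X \<Longrightarrow> f x = g x) \<Longrightarrow> wirt j f z = wirt j g z"
  unfolding wirt_eq_gen by (rule wirt_gen_cong)

lemma wirt_bar_cong: "open X \<Longrightarrow> z \<in> X \<Longrightarrow> (\<And>x. x \<in> X \<Longrightarrow> f x = g x) \<Longrightarrow> wirt_bar j f z = wirt_bar j g z"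
  unfolding wirt_bar_eq_gen by (rule wirt_gen_cong)

text \<open>A relational form of the operators, so that derivatives of explicit expressions can be assembled by
  resolution in the manner of \<open>derivative_intros\<close>.\<close>

definition has_wirt :: "complex \<Rightarrow> 'n \<Rightarrow> (complex ^ 'n::finite \<Rightarrow> complex) \<Rightarrow> complex \<Rightarrow> complex ^ 'n \<Rightarrow> bool" where
  "has_wirt c j f d z \<longleftrightarrow> f differentiable (at z) \<and> wirt_gen c j f z = d"

lemma has_wirtD: "has_wirt c j f d z \<Longrightarrow> wirt_gen c j f z = d"
  by (simp add: has_wirt_def)

lemma has_wirt_eq_rhs: "has_wirt c j f d z \<Longrightarrow> d = d' \<Longrightarrow> has_wirt c j f d' z"
  by simp

lemma has_wirtI:
  assumes "(f has_derivative f') (at z)" "(f' (axis j 1) + c * f' (axis j \<i>)) / 2 = d"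
  shows "has_wirt c j f d z"
  using assms frechet_derivative_eqI[OF assms(1)]
  by (auto simp: has_wirt_def wirt_gen_def differentiable_def)

lemma has_wirtE:
  assumes "has_wirt c j f d z"
  obtains f' where "(f has_derivative f') (at z)" "d = (f' (axis j 1) + c * f' (axis j \<i>)) / 2"
  using assms by (auto simp: has_wirt_def wirt_gen_def frechet_derivative_works)

lemma smooth_on_has_wirt:
  "smooth_on X f \<Longrightarrow> z \<in> X \<Longrightarrow> has_wirt c j f (wirt_gen c j f z) z"
  by (simp add: has_wirt_def smooth_on_differentiable)

lemma has_wirt_linear:
  assumes "bounded_linear h" shows "has_wirt c j h ((h (axis j 1) + c * h (axis j \<i>)) / 2) z"
  by (rule has_wirtI[OF bounded_linear_imp_has_derivative[OF assms]]) simp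

lemma has_wirt_const: "has_wirt c j (\<lambda>z. a) 0 z"
  by (rule has_wirtI[OF has_derivative_const]) simp

lemma has_wirt_nth: "has_wirt c j (\<lambda>z. z $ i) (if i = j then (1 + c * \<i>) / 2 else 0) z"
  by (rule has_wirt_eq_rhs[OF has_wirt_linear[OF bounded_linear_vec_nth]]) (simp add: axis_def)

lemma has_wirt_cnj_nth: "has_wirt c j (\<lambda>z. cnj (z $ i)) (if i = j then (1 - c * \<i>) / 2 else 0) z"
  by (rule has_wirt_eq_rhs[OF has_wirt_linear[OF bounded_linear_compose[OF bounded_linear_cnj bounded_linear_vec_nth]]])
     (simp add: axis_def)

lemma has_wirt_add:
  assumes "has_wirt c j f a z" "has_wirt c j g b z"
  shows "has_wirt c j (\<lambda>z. f z + g z) (a + b) z"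
  using assms
  by (elim has_wirtE) (rule has_wirtI[OF has_derivative_add], auto simp: field_simps)

lemma has_wirt_diff:
  assumes "has_wirt c j f a z" "has_wirt c j g b z"
  shows "has_wirt c j (\<lambda>z. f z - g z) (a - b) z"
  using assms
  by (elim has_wirtE) (rule has_wirtI[OF has_derivative_diff], auto simp: field_simps)

lemma has_wirt_mult:
  assumes "has_wirt c j f a z" "has_wirt c j g b z"
  shows "has_wirt c j (\<lambda>z. f z * g z) (f z * b + a * g z) z"
  using assms
  by (elim has_wirtE) (rule has_wirtI[OF has_derivative_mult], auto simp: add_divide_distrib algebra_simps)

lemma has_wirt_inverse:
  assumes "has_wirt c j f a z" "f z \<noteq> 0"
  shows "has_wirt c j (\<lambda>z. inverse (f z)) (- (inverse (f z) * a * inverse (f z))) z"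
  using assms
  by (elim has_wirtE) (rule has_wirtI[OF Deriv.has_derivative_inverse], auto simp: add_divide_distrib diff_divide_distrib algebra_simps)

lemma has_wirt_minus:
  assumes "has_wirt c j f a z" shows "has_wirt c j (\<lambda>z. - f z) (- a) z"
  using has_wirt_diff[OF has_wirt_const assms, of 0] by simp

lemma has_wirt_cnj:
  assumes "has_wirt c j f a z" shows "has_wirt (cnj c) j (\<lambda>z. cnj (f z)) (cnj a) z"
  using assms
  by (elim has_wirtE) (rule has_wirtI[OF has_derivative_cnj], auto simp: add_divide_distrib algebra_simps)

lemma wirt_gen_commute:
  assumes "open X" "smooth_on X f" "z \<in> X"
  shows "wirt_gen c i (wirt_gen d j f) z = wirt_gen d j (wirt_gen c i f) z"
proof -
  define DD where "DD u v = frechet_derivative (\<lambda>y. frechet_derivative f (at y) u) (at z) v" for u v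
  have sym: "DD u v = DD v u" for u v
    unfolding DD_def by (rule frechet_derivative_commute[OF assms])
  have 1: "frechet_derivative (wirt_gen d j f) (at z) v = (DD (axis j 1) v + d * DD (axis j \<i>) v) / 2" for d j v
  proof -
    have "(wirt_gen d j f has_derivative (\<lambda>v. (DD (axis j 1) v + d * DD (axis j \<i>) v) / 2)) (at z)"
      unfolding wirt_gen_def[abs_def] DD_def
      by (auto intro!: derivative_eq_intros smooth_on_has_derivative[OF smooth_on_frechet[OF assms(2)] assms(3)])
    then show ?thesis using frechet_derivative_eqI by metis
  qed
  show ?thesis
    unfolding wirt_gen_def[of _ _ "wirt_gen _ _ _"] 1 by (simp add: field_simps sym[of "axis i _"])
qed

lemma wirt_gen_cnj:
  assumes "f differentiable (at z)"
  shows "wirt_gen (cnj c) j (\<lambda>z. cnj (f z)) z = cnj (wirt_gen c j f z)"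
  using has_wirt_cnj[of c j f "wirt_gen c j f z" z] assms by (simp add: has_wirt_def)

lemma bounded_linear_axis: "bounded_linear (axis j :: complex \<Rightarrow> complex^'n::finite)"
  unfolding linear_conv_bounded_linear[symmetric]
  by (rule linearI) (simp_all add: vec_eq_iff axis_def)

text \<open>The Cauchy-Riemann equations make the real derivative of \<open>f\<close> complex linear, so \<open>f\<close> is
  holomorphic along every holomorphic curve. All uses of holomorphy below go through such curves, and
  only function theory of one variable is needed.\<close>

lemma dbar_closed_field_differentiable:
  fixes f :: "complex ^ 'n::finite \<Rightarrow> complex"
  assumes f: "f differentiable (at (\<gamma> s))" and dbar: "\<And>j. wirt_bar j f (\<gamma> s) = 0"
    and \<gamma>: "\<And>i. ((\<lambda>s. \<gamma> s $ i) has_field_derivative \<gamma>' i) (at s)"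
  shows "(\<lambda>s. f (\<gamma> s)) field_differentiable (at s)"
proof -
  let ?D = "frechet_derivative f (at (\<gamma> s))"
  have D: "(f has_derivative ?D) (at (\<gamma> s))" using f frechet_derivative_works by blast
  then have lin: "bounded_linear ?D" by (rule has_derivative_bounded_linear)
  have ax: "?D (axis j a) = a * ?D (axis j 1)" for j a
  proof -
    have "?D (axis j 1) + \<i> * ?D (axis j \<i>) = 0"
      using dbar[of j] by (simp add: wirt_bar_def)
    then have "\<i> * (?D (axis j 1) + \<i> * ?D (axis j \<i>)) = 0" by simp
    then have i: "?D (axis j \<i>) = \<i> * ?D (axis j 1)"
      by (simp add: algebra_simps)
    have "axis j a = Re a *\<^sub>R axis j 1 + Im a *\<^sub>R (axis j \<i> :: complex^'n)"
      by (simp add: vec_eq_iff axis_def complex_eq_iff)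
    then have "?D (axis j a) = Re a *\<^sub>R ?D (axis j 1) + Im a *\<^sub>R ?D (axis j \<i>)"
      using lin by (simp add: linear_simps)
    also have "\<dots> = (Re a + \<i> * Im a) * ?D (axis j 1)" by (simp add: i scaleR_conv_of_real algebra_simps)
    finally show ?thesis by (simp add: complex_eq[symmetric])
  qed
  have vec: "v = (\<Sum>j\<in>UNIV. axis j (v $ j))" for v :: "complex^'n"
    by (simp add: vec_eq_iff axis_def)
  have "((\<lambda>s. \<Sum>j\<in>UNIV. axis j (\<gamma> s $ j)) has_derivative (\<lambda>h. \<Sum>j\<in>UNIV. axis j (\<gamma>' j * h))) (at s)"
    using \<gamma> by (intro has_derivative_sum bounded_linear.has_derivative[OF bounded_linear_axis]) (simp add: has_field_derivative_def)
  from diff_chain_at[OF this[folded vec] D]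
  have "((\<lambda>s. f (\<gamma> s)) has_derivative (\<lambda>h. ?D (\<Sum>j\<in>UNIV. axis j (\<gamma>' j * h)))) (at s)" by (simp add: o_def)
  moreover have "?D (\<Sum>j\<in>UNIV. axis j (\<gamma>' j * h)) = (\<Sum>j\<in>UNIV. \<gamma>' j * ?D (axis j 1)) * h" for h
    unfolding linear_sum[OF bounded_linear.linear[OF lin]] sum_distrib_right
    by (intro sum.cong refl) (subst ax, simp)
  ultimately have "((\<lambda>s. f (\<gamma> s)) has_field_derivative (\<Sum>j\<in>UNIV. \<gamma>' j * ?D (axis j 1))) (at s)"
    by (simp add: has_field_derivative_def)
  then show ?thesis by (auto simp: field_differentiable_def)
qed

lemma set2_cases:
  fixes I :: "2 set"
  obtains "I = {}" | "I = {1}" | "I = {2}" | "I = {1,2}"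
  using subset_UNIV[of I] unfolding UNIV_2 by blast

text \<open>In the order on the index type \<open>2\<close> the numeral \<open>2\<close> denotes \<open>0\<close>, so the increasing
  order of the indices is \<open>2, 1\<close>; this fixes the signs in the operators on forms.\<close>

lemma two_less_one: "(2::2) < 1" "\<not> (1::2) < 2"
proof -
  have "(2::2) = 0" by simp
  then show "(2::2) < 1" "\<not> (1::2) < 2"
    by (simp_all only: less_bit0_def bit0.Rep_0 bit0.Rep_1)
qed

lemma alternating_sum_2:
  fixes F :: "2 \<Rightarrow> complex"
  shows "(\<Sum>i\<in>{1,2}. (-1) ^ (n + card {k \<in> {1,2}. k < i}) * F i) = (-1) ^ n * (F 2 - F 1)"
proof -
  have 1: "{k \<in> {1,2::2}. k < 1} = {2}" and 2: "{k \<in> {1,2::2}. k < 2} = {}"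
    using two_less_one by auto
  have "(\<Sum>i\<in>{1,2}. (-1) ^ (n + card {k \<in> {1,2}. k < i}) * F i)
      = (-1) ^ (n + card {k \<in> {1,2::2}. k < 1}) * F 1 + (-1) ^ (n + card {k \<in> {1,2::2}. k < 2}) * F 2"
    by (subst sum.insert) auto
  then show ?thesis unfolding 1 2 by (simp add: algebra_simps)
qed

lemma del_simps:
  fixes \<omega> :: "2 form"
  assumes "z \<in> X"
  shows "del X \<omega> {} J z = 0"
    "del X \<omega> {i} J z = wirt i (\<omega> {} J) z"
    "del X \<omega> {1,2} J z = wirt 2 (\<omega> {1} J) z - wirt 1 (\<omega> {2} J) z"
proof -
  have d: "{1,2} - {1} = {2::2}" "{1,2} - {2} = {1::2}" by auto
  show "del X \<omega> {1,2} J z = wirt 2 (\<omega> {1} J) z - wirt 1 (\<omega> {2} J) z"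
    using alternating_sum_2[of 0 "\<lambda>i. wirt i (\<omega> ({1,2} - {i}) J) z", unfolded d] assms
    unfolding del_def by simp
  have none: "(k = i \<and> k < i) = False" for k by auto
  show "del X \<omega> {i} J z = wirt i (\<omega> {} J) z"
    using assms by (simp add: del_def none)
qed (simp add: del_def)

lemma delbar_simps:
  fixes \<omega> :: "2 form"
  assumes "z \<in> X"
  shows "delbar X \<omega> I {} z = 0"
    "delbar X \<omega> I {j} z = (-1) ^ card I * wirt_bar j (\<omega> I {}) z"
    "delbar X \<omega> I {1,2} z = (-1) ^ card I * (wirt_bar 2 (\<omega> I {1}) z - wirt_bar 1 (\<omega> I {2}) z)"
proof -
  have d: "{1,2} - {1} = {2::2}" "{1,2} - {2} = {1::2}" by auto
  show "delbar X \<omega> I {1,2} z = (-1) ^ card I * (wirt_bar 2 (\<omega> I {1}) z - wirt_bar 1 (\<omega> I {2}) z)"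
    using alternating_sum_2[of "card I" "\<lambda>j. wirt_bar j (\<omega> I ({1,2} - {j})) z", unfolded d] assms
    unfolding delbar_def by simp
  have none: "(k = j \<and> k < j) = False" for k by auto
  show "delbar X \<omega> I {j} z = (-1) ^ card I * wirt_bar j (\<omega> I {}) z"
    using assms by (simp add: delbar_def none)
qed (simp add: delbar_def)

lemma wirt_gen_diff:
  assumes "f differentiable (at z)" "g differentiable (at z)"
  shows "wirt_gen c j (\<lambda>z. f z - g z) z = wirt_gen c j f z - wirt_gen c j g z"
  by (rule has_wirtD[OF has_wirt_diff]) (simp_all add: has_wirt_def assms)

lemma real_plane_iff: "z \<in> real_plane \<longleftrightarrow> Im (z $ 1) = 0 \<and> Im (z $ 2) = 0"
  by (simp add: real_plane_def forall_2 complex_is_Real_iff)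

lemma closed_real_plane: "closed real_plane"
proof -
  have "real_plane = {z. Im (z $ 1) = 0} \<inter> {z. Im (z $ 2) = 0}"
    by (auto simp: real_plane_iff)
  moreover have "closed \<dots>"
    by (intro closed_Int closed_Collect_eq continuous_intros)
  ultimately show ?thesis by simp
qed

section \<open>A nonzero class in Aeppli cohomology\<close>

definition sqnorm :: "complex ^ 2 \<Rightarrow> complex" where
  "sqnorm z = z $ 1 * cnj (z $ 1) + z $ 2 * cnj (z $ 2)"

text \<open>Up to a constant, \<open>bm_coeff 1 d(cnj z\<^sub>1) + bm_coeff 2 d(cnj z\<^sub>2)\<close> is the Bochner-Martinelli kernel of
  \<open>\<complex>\<^sup>2\<close> with pole at the origin. As a class in \<open>H\<^sup>1(X, O)\<close> it represents the delta
  hyperfunction on the real plane.\<close>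

definition bm_coeff :: "2 \<Rightarrow> complex ^ 2 \<Rightarrow> complex" where
  "bm_coeff j z = (if j = 1 then - cnj (z $ 2) else cnj (z $ 1)) * (inverse (sqnorm z) * inverse (sqnorm z))"

text \<open>On \<open>z\<^sub>1 \<noteq> 0\<close> the kernel is the \<open>\<partial>\<close>-bar derivative of \<open>cnj z\<^sub>2 / (z\<^sub>1 |z|\<^sup>2)\<close>. The
  function below is \<open>- z\<^sub>1\<^sup>2\<close> times the \<open>\<partial>/\<partial>z\<^sub>1\<close>-derivative of that primitive; the factor
  removes the pole along \<open>z\<^sub>1 = 0\<close>, where the value left is \<open>1 / z\<^sub>2\<close>.\<close>

definition bm_potential :: "complex ^ 2 \<Rightarrow> complex" where
  "bm_potential z = cnj (z $ 2) * (2 * (z $ 1 * cnj (z $ 1)) + z $ 2 * cnj (z $ 2))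
           * (inverse (sqnorm z) * inverse (sqnorm z))"

lemma sqnorm_nonzero:
  assumes "z \<notin> real_plane" shows "sqnorm z \<noteq> 0"
proof
  assume "sqnorm z = 0"
  then have "(cmod (z $ 1))\<^sup>2 + (cmod (z $ 2))\<^sup>2 = 0"
    unfolding sqnorm_def complex_norm_square[symmetric] of_real_add[symmetric] of_real_eq_0_iff
    by simp
  then have "z $ 1 = 0" "z $ 2 = 0" by (simp_all add: add_nonneg_eq_0_iff)
  with assms show False by (simp add: real_plane_iff)
qed

lemma smooth_on_sqnorm: "open X \<Longrightarrow> smooth_on X sqnorm"
  unfolding sqnorm_def[abs_def] by (intro smooth_on_intros)

lemma smooth_on_bm_coeff:
  assumes "open X" "\<And>z. z \<in> X \<Longrightarrow> sqnorm z \<noteq> 0"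
  shows "smooth_on X (bm_coeff j)"
  unfolding bm_coeff_def[abs_def]
  by (cases "j = 1") (use assms in \<open>auto intro!: smooth_on_intros smooth_on_sqnorm\<close>)

lemma has_wirt_sqnorm:
  "has_wirt c j sqnorm ((1 + c * \<i>) / 2 * cnj (z $ j) + (1 - c * \<i>) / 2 * z $ j) z"
proof -
  have j: "j = 1 \<or> j = 2" using exhaust_2 by blast
  show ?thesis
    unfolding sqnorm_def[abs_def]
    by (rule has_wirt_eq_rhs[OF has_wirt_add[OF has_wirt_mult[OF has_wirt_nth has_wirt_cnj_nth]
          has_wirt_mult[OF has_wirt_nth has_wirt_cnj_nth]]]) (use j in auto)
qed

lemma has_wirt_inv_sqnorm2:
  assumes "sqnorm z \<noteq> 0"
  shows "has_wirt c j (\<lambda>z. inverse (sqnorm z) * inverse (sqnorm z))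
     (- 2 * ((1 + c * \<i>) / 2 * cnj (z $ j) + (1 - c * \<i>) / 2 * z $ j) * inverse (sqnorm z) ^ 3) z"
proof -
  have "m * - (m * D * m) + - (m * D * m) * m = - 2 * D * m ^ 3" for m D :: complex
    by (simp add: power3_eq_cube)
  then show ?thesis
    by (rule has_wirt_eq_rhs[OF has_wirt_mult[OF has_wirt_inverse[OF has_wirt_sqnorm assms] has_wirt_inverse[OF has_wirt_sqnorm assms]]])
qed

lemma has_wirt_bm_coeff1:
  assumes "sqnorm z \<noteq> 0"
  shows "has_wirt c j (bm_coeff 1)
    (- cnj (z $ 2) * (- 2 * ((1 + c * \<i>) / 2 * cnj (z $ j) + (1 - c * \<i>) / 2 * z $ j) * inverse (sqnorm z) ^ 3)
       - (if j = 2 then (1 - c * \<i>) / 2 else 0) * (inverse (sqnorm z) * inverse (sqnorm z))) z"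
  unfolding bm_coeff_def[abs_def] if_P[OF refl]
  by (rule has_wirt_eq_rhs[OF has_wirt_mult[OF has_wirt_minus[OF has_wirt_cnj_nth] has_wirt_inv_sqnorm2[OF assms]]]) auto

lemma has_wirt_bm_coeff2:
  assumes "sqnorm z \<noteq> 0"
  shows "has_wirt c j (bm_coeff 2)
    (cnj (z $ 1) * (- 2 * ((1 + c * \<i>) / 2 * cnj (z $ j) + (1 - c * \<i>) / 2 * z $ j) * inverse (sqnorm z) ^ 3)
       + (if j = 1 then (1 - c * \<i>) / 2 else 0) * (inverse (sqnorm z) * inverse (sqnorm z))) z"
proof -
  have "bm_coeff 2 = (\<lambda>z. cnj (z $ 1) * (inverse (sqnorm z) * inverse (sqnorm z)))"
    by (simp add: bm_coeff_def fun_eq_iff)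
  then show ?thesis
    by (simp only:) (rule has_wirt_eq_rhs[OF has_wirt_mult[OF has_wirt_cnj_nth has_wirt_inv_sqnorm2[OF assms]]], auto)
qed

lemma bm_coeff_dbar_closed:
  assumes "sqnorm z \<noteq> 0"
  shows "wirt_bar 2 (bm_coeff 1) z = wirt_bar 1 (bm_coeff 2) z"
proof -
  define m where "m = inverse (sqnorm z)"
  have m: "m * (z $ 1 * cnj (z $ 1) + z $ 2 * cnj (z $ 2)) = 1"
    using assms by (simp add: m_def sqnorm_def)
  have "wirt_bar 2 (bm_coeff 1) z = 2 * cnj (z $ 2) * z $ 2 * m ^ 3 - m * m"
    unfolding wirt_bar_eq_gen has_wirtD[OF has_wirt_bm_coeff1[OF assms]] by (simp add: m_def)
  moreover have "wirt_bar 1 (bm_coeff 2) z = m * m - 2 * cnj (z $ 1) * z $ 1 * m ^ 3"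
    unfolding wirt_bar_eq_gen has_wirtD[OF has_wirt_bm_coeff2[OF assms]] by (simp add: m_def)
  ultimately show ?thesis using m by algebra
qed

lemma has_wirt_bm_potential:
  assumes "sqnorm z \<noteq> 0"
  shows "has_wirt \<i> j bm_potential (- (z $ 1 * z $ 1 * wirt 1 (bm_coeff j) z)) z"
proof -
  define m where "m = inverse (sqnorm z)"
  have m: "m * (z $ 1 * cnj (z $ 1) + z $ 2 * cnj (z $ 2)) = 1"
    using assms by (simp add: m_def sqnorm_def)
  have t1: "wirt 1 (bm_coeff 1) z = 2 * cnj (z $ 2) * cnj (z $ 1) * m ^ 3"
    unfolding wirt_eq_gen has_wirtD[OF has_wirt_bm_coeff1[OF assms]] by (simp add: m_def)
  have t2: "wirt 1 (bm_coeff 2) z = - 2 * cnj (z $ 1) * cnj (z $ 1) * m ^ 3"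
    unfolding wirt_eq_gen has_wirtD[OF has_wirt_bm_coeff2[OF assms]] by (simp add: m_def)
  note bm_potential = has_wirt_mult[OF has_wirt_mult[OF has_wirt_cnj_nth
      has_wirt_add[OF has_wirt_mult[OF has_wirt_const has_wirt_mult[OF has_wirt_nth has_wirt_cnj_nth]] has_wirt_mult[OF has_wirt_nth has_wirt_cnj_nth]]]
      has_wirt_inv_sqnorm2[OF assms]]
  have "j = 1 \<or> j = 2" using exhaust_2 by blast
  then show ?thesis
  proof
    assume j: "j = 1"
    show ?thesis
      unfolding bm_potential_def[abs_def] j t1
      by (rule has_wirt_eq_rhs[OF bm_potential]) (simp add: m_def[symmetric], use m in algebra)
  next
    assume j: "j = 2"
    show ?thesis
      unfolding bm_potential_def[abs_def] j t2
      by (rule has_wirt_eq_rhs[OF bm_potential]) (simp add: m_def[symmetric], use m in algebra)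
  qed
qed

text \<open>The obstruction. If \<open>w\<close> existed, then \<open>P = z\<^sub>1\<^sup>2 w + bm_potential\<close> would be holomorphic on \<open>X\<close>.
  Restrict \<open>P\<close> to the parabolas \<open>z\<^sub>2 = \<i> (t + z\<^sub>1\<^sup>2)\<close>. For \<open>t > 0\<close> they miss the real
  plane, since real \<open>z\<^sub>1\<close> forces \<open>Im z\<^sub>2 = t + z\<^sub>1\<^sup>2 > 0\<close>, and at \<open>t = 0\<close> they touch it only in the
  origin. Hence the circles \<open>|z\<^sub>1| = 1\<close>, \<open>0 \<le> t \<le> 1\<close>, sweep out a compact subset of \<open>X\<close>, on which
  \<open>P\<close> is bounded, while at the centre \<open>P (0, \<i> t) = 1 / (\<i> t)\<close> whatever \<open>w\<close> is. This
  contradicts the maximum principle as \<open>t\<close> tends to \<open>0\<close>.\<close>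

lemma d1_bm_coeff_not_dbar_exact:
  assumes "smooth_on (UNIV - real_plane) w"
    and "\<And>z j. z \<notin> real_plane \<Longrightarrow> wirt_bar j w z = wirt 1 (bm_coeff j) z"
  shows False
proof -
  define X where "X = UNIV - real_plane"
  have oX: "open X" unfolding X_def using closed_real_plane by (simp add: open_Diff)
  define P where "P z = z $ 1 * z $ 1 * w z + bm_potential z" for z
  have P: "has_wirt \<i> j P 0 z" if "z \<in> X" for j z
  proof -
    have nz: "sqnorm z \<noteq> 0" using that sqnorm_nonzero by (auto simp: X_def)
    have w: "has_wirt \<i> j w (wirt 1 (bm_coeff j) z) z"
      using smooth_on_has_wirt[of X w z \<i> j] assms that by (auto simp: X_def wirt_bar_eq_gen)
    show ?thesis
      unfolding P_def[abs_def]
      by (rule has_wirt_eq_rhs[OF has_wirt_add[OF has_wirt_mult[OF has_wirt_mult[OF has_wirt_nth has_wirt_nth] w] has_wirt_bm_potential[OF nz]]])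
         simp
  qed
  define \<gamma> where "\<gamma> t s = (vector [s, \<i> * (of_real t + s * s)] :: complex ^ 2)" for t :: real and s :: complex
  have \<gamma>X: "\<gamma> t s \<in> X" if "t \<ge> 0" "t > 0 \<or> s \<noteq> 0" for t s
  proof (rule ccontr)
    assume "\<gamma> t s \<notin> X"
    then have "Im s = 0" "t + Re s * Re s = 0"
      by (auto simp: X_def real_plane_iff \<gamma>_def)
    then show False using that by (simp add: add_nonneg_eq_0_iff complex_eq_iff)
  qed
  have contP: "continuous_on X P"
    using P by (intro continuous_at_imp_continuous_on ballI differentiable_imp_continuous_within) (auto simp: has_wirt_def)
  have contg: "continuous_on S (\<lambda>p. \<gamma> (fst p) (snd p))" for S
  proof -
    have \<gamma>_eq: "\<gamma> t s = (\<chi> i. if i = 1 then s else \<i> * (of_real t + s * s))" for t s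
      by (simp add: \<gamma>_def vec_eq_iff forall_2)
    show ?thesis
      unfolding \<gamma>_eq
    proof (rule continuous_on_vec_lambda)
      show "continuous_on S (\<lambda>p. if i = 1 then snd p else \<i> * (of_real (fst p) + snd p * snd p))" for i :: 2
        by (cases "i = 1") (auto intro!: continuous_intros)
    qed
  qed
  have "compact ((\<lambda>p. P (\<gamma> (fst p) (snd p))) ` ({0..1} \<times> sphere 0 1))"
    by (intro compact_continuous_image continuous_on_compose2[OF contP contg] compact_Times)
       (auto intro!: \<gamma>X)
  then obtain B where B: "B > 0"
    "\<And>x. x \<in> (\<lambda>p. P (\<gamma> (fst p) (snd p))) ` ({0..1} \<times> sphere 0 1) \<Longrightarrow> norm x \<le> B"
    using compact_imp_bounded[THEN bounded_pos[THEN iffD1]] by metis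
  have bound: "norm (P (\<gamma> t s)) \<le> B" if "0 \<le> t" "t \<le> 1" "norm s = 1" for t s
    by (rule B(2), rule image_eqI[of _ _ "(t, s)"]) (use that in auto)
  \<comment> \<open>the centre value then has modulus \<open>B + 1\<close>, exceeding the bound on the circle\<close>
  define t where "t = 1 / (B + 1)"
  have t: "0 < t" "t \<le> 1" using B(1) by (auto simp: t_def)
  have hol: "(\<lambda>s. P (\<gamma> t s)) holomorphic_on S" for S
    unfolding holomorphic_on_def
  proof (rule ballI, rule field_differentiable_at_within)
    fix s
    have X: "\<gamma> t s \<in> X" using t by (intro \<gamma>X) auto
    show "(\<lambda>s. P (\<gamma> t s)) field_differentiable at s"
    proof (rule dbar_closed_field_differentiable)
      show "P differentiable (at (\<gamma> t s))" "wirt_bar j P (\<gamma> t s) = 0" for j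
        using P[OF X, of j] by (auto simp: has_wirt_def wirt_bar_eq_gen)
      show "((\<lambda>s. \<gamma> t s $ i) has_field_derivative (if i = 1 then 1 else \<i> * (2 * s))) (at s)" for i
        using exhaust_2[of i] by (auto simp: \<gamma>_def intro!: derivative_eq_intros)
    qed
  qed
  have "norm (P (\<gamma> t 0)) \<le> B"
    by (rule maximum_modulus_frontier[OF hol holomorphic_on_imp_continuous_on[OF hol], of "cball 0 1"])
       (use bound t in auto)
  moreover have "norm (P (\<gamma> t 0)) = 1 / t"
    using t by (simp add: P_def bm_potential_def sqnorm_def \<gamma>_def norm_mult norm_inverse norm_divide field_simps)
  ultimately show False using B(1) by (simp add: t_def)
qed

text \<open>The form \<open>dz\<^sub>2 \<and> (bm_coeff 1 d(cnj z\<^sub>1) + bm_coeff 2 d(cnj z\<^sub>2))\<close>, restricted to \<open>X\<close>.\<close>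

definition bm_form :: "2 form" where
  "bm_form I J z = (if z \<notin> real_plane \<and> I = {2} \<and> card J = 1 then bm_coeff (the_elem J) z else 0)"

lemma zero_in_forms: "0 \<in> forms p q X"
  by (auto simp: forms_def smooth_on_const zero_fun_def)

lemma wirt_gen_zero: "wirt_gen c j (\<lambda>z. 0) = (\<lambda>z. 0)"
  by (rule ext) (rule has_wirtD[OF has_wirt_const])

lemma wirt_zero: "wirt j (\<lambda>z. 0) = (\<lambda>z. 0)" "wirt_bar j (\<lambda>z. 0) = (\<lambda>z. 0)"
  unfolding wirt_eq_gen wirt_bar_eq_gen by (rule wirt_gen_zero)+

lemma del_zero: "del X (0 :: 'n form) = (0 :: 'n::{finite,linorder} form)"
  by (simp add: fun_eq_iff del_def zero_fun_def wirt_zero)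

lemma delbar_zero: "delbar X (0 :: 'n form) = (0 :: 'n::{finite,linorder} form)"
  by (simp add: fun_eq_iff delbar_def zero_fun_def wirt_zero)

lemma bm_form_dbar_closed: "delbar (UNIV - real_plane) bm_form = 0"
proof (intro ext)
  fix I J z
  let ?X = "UNIV - real_plane :: (complex^2) set"
  have oX: "open ?X" using closed_real_plane by (simp add: open_Diff)
  show "delbar ?X bm_form I J z = 0 I J z"
  proof (cases "z \<in> ?X")
    case z: True
    have e: "bm_form I {j} x = (if I = {2} then bm_coeff j x else 0)" if "x \<in> ?X" for x j I
      using that by (simp add: bm_form_def)
    have e': "bm_form I {} = (\<lambda>x. 0)" for I by (simp add: bm_form_def fun_eq_iff)
    have c: "wirt_bar i (bm_form I {j}) z = wirt_bar i (\<lambda>x. if I = {2} then bm_coeff j x else 0) z" for i j I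
      by (rule wirt_bar_cong[OF oX z e])
    show ?thesis
      by (cases J rule: set2_cases; cases "I = {2}")
        (use z sqnorm_nonzero bm_coeff_dbar_closed[of z] in \<open>auto simp: delbar_simps e' c zero_fun_def wirt_zero\<close>)
  qed (simp add: delbar_def zero_fun_def)
qed

lemma bm_form_in_forms: "bm_form \<in> forms 1 1 (UNIV - real_plane)"
  unfolding forms_def
proof (intro CollectI conjI allI impI)
  fix I J
  have oX: "open (UNIV - real_plane)" using closed_real_plane by (simp add: open_Diff)
  show "smooth_on (UNIV - real_plane) (bm_form I J)"
  proof (rule smooth_on_cong[OF oX])
    show "smooth_on (UNIV - real_plane) (\<lambda>z. if I = {2} \<and> card J = 1 then bm_coeff (the_elem J) z else 0)"
    proof (cases "I = {2} \<and> card J = 1")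
      case True
      have "smooth_on (UNIV - real_plane) (bm_coeff (the_elem J))"
        using sqnorm_nonzero by (intro smooth_on_bm_coeff oX) auto
      then show ?thesis using True by simp
    next
      case False
      then show ?thesis by (simp only: if_False smooth_on_const)
    qed
  qed (simp add: bm_form_def)
  show "bm_form I J = 0" if "card I \<noteq> 1 \<or> card J \<noteq> 1"
    using that by (auto simp: bm_form_def fun_eq_iff)
qed (simp add: bm_form_def)

text \<open>If \<open>u\<close> and \<open>v\<close> exhibit the form as a coboundary, apply \<open>\<partial>\<close>: the contribution of \<open>u\<close>
  drops out and that of \<open>v\<close> becomes, up to sign, the \<open>\<partial>\<close>-bar derivative of the single
  coefficient \<open>w\<close> of \<open>\<partial>v\<close>. So the \<open>\<partial>/\<partial>z\<^sub>1\<close>-derivative of the Bochner-Martinelli kernel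
  would be \<open>\<partial>\<close>-bar exact on \<open>X\<close>.\<close>

lemma bm_form_not_coboundary: "bm_form \<notin> A_coboundaries (UNIV - real_plane)"
proof
  let ?X = "UNIV - real_plane :: (complex^2) set"
  have oX: "open ?X" using closed_real_plane by (simp add: open_Diff)
  assume "bm_form \<in> A_coboundaries ?X"
  then obtain u v where u: "u \<in> forms 0 1 ?X" and v: "v \<in> forms 1 0 ?X"
    and uv: "bm_form = del ?X u + delbar ?X v"
    by (auto simp: A_coboundaries_def set_plus_def)
  define U where "U j = u {} {j}" for j
  define V where "V i = v {i} {}" for i
  have U: "smooth_on ?X (U j)" and V: "smooth_on ?X (V i)" for i j
    using u v by (auto simp: U_def V_def forms_def)
  have eq: "bm_form {i} {j} z = wirt i (U j) z - wirt_bar j (V i) z" if "z \<in> ?X" for i j z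
    using that by (simp add: uv U_def V_def del_simps delbar_simps)
  have 1: "wirt 1 (U j) z = wirt_bar j (V 1) z" if "z \<in> ?X" for j z
    using eq[OF that, of 1 j] by (simp add: bm_form_def)
  have 2: "bm_coeff j z = wirt 2 (U j) z - wirt_bar j (V 2) z" if "z \<in> ?X" for j z
    using eq[OF that, of 2 j] that by (simp add: bm_form_def)
  define w where "w z = wirt 2 (V 1) z - wirt 1 (V 2) z" for z
  note diff = smooth_on_differentiable[OF smooth_on_wirt[OF oX]] smooth_on_differentiable[OF smooth_on_wirt_bar[OF oX]]
  show False
  proof (rule d1_bm_coeff_not_dbar_exact)
    show "smooth_on ?X w"
      unfolding w_def[abs_def] by (intro smooth_on_diff smooth_on_wirt oX V)
    fix z :: "complex^2" and j assume "z \<notin> real_plane"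
    then have z: "z \<in> ?X" by simp
    have "wirt 1 (bm_coeff j) z = wirt 1 (\<lambda>x. wirt 2 (U j) x - wirt_bar j (V 2) x) z"
      by (rule wirt_cong[OF oX z 2])
    also have "\<dots> = wirt 1 (wirt 2 (U j)) z - wirt 1 (wirt_bar j (V 2)) z"
      unfolding wirt_eq_gen[of] by (rule wirt_gen_diff) (use diff U V z in \<open>simp_all add: wirt_eq_gen\<close>)
    also have "wirt 1 (wirt 2 (U j)) z = wirt 2 (wirt 1 (U j)) z"
      unfolding wirt_eq_gen by (rule wirt_gen_commute[OF oX U z])
    also have "wirt 2 (wirt 1 (U j)) z = wirt 2 (wirt_bar j (V 1)) z"
      by (rule wirt_cong[OF oX z 1])
    also have "wirt 2 (wirt_bar j (V 1)) z = wirt_bar j (wirt 2 (V 1)) z"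
      unfolding wirt_eq_gen wirt_bar_eq_gen by (rule wirt_gen_commute[OF oX V z])
    also have "wirt 1 (wirt_bar j (V 2)) z = wirt_bar j (wirt 1 (V 2)) z"
      unfolding wirt_eq_gen wirt_bar_eq_gen by (rule wirt_gen_commute[OF oX V z])
    also have "wirt_bar j (wirt 2 (V 1)) z - wirt_bar j (wirt 1 (V 2)) z = wirt_bar j w z"
      unfolding wirt_bar_eq_gen w_def[abs_def]
      by (rule wirt_gen_diff[symmetric]) (use diff V z in auto)
    finally show "wirt_bar j w z = wirt 1 (bm_coeff j) z" by simp
  qed
qed

lemma H11_A_nonzero: "H11_A (UNIV - real_plane) \<noteq> {0 +o A_coboundaries (UNIV - real_plane)}"
proof
  let ?X = "UNIV - real_plane :: (complex^2) set"
  let ?B = "A_coboundaries ?X"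
  assume "H11_A ?X = {0 +o ?B}"
  moreover have "bm_form \<in> A_cocycles ?X"
    unfolding A_cocycles_def using bm_form_in_forms by (simp only: mem_Collect_eq bm_form_dbar_closed del_zero)
  ultimately have "bm_form +o ?B = 0 +o ?B"
    unfolding H11_A_def quot_def by blast
  moreover have "0 \<in> ?B"
  proof -
    have "del ?X 0 + delbar ?X 0 \<in> ?B"
      unfolding A_coboundaries_def by (intro set_plus_intro imageI zero_in_forms)
    then show ?thesis by (simp only: del_zero delbar_zero add_0_left)
  qed
  ultimately have "bm_form + 0 \<in> 0 +o ?B" by (metis set_plus_intro2)
  then show False using bm_form_not_coboundary by (simp add: elt_set_plus_def)
qed

section \<open>The Cauchy transform\<close>

text \<open>A convolution with the push-forward along \<open>\<gamma>\<close> of the density \<open>q\<close>. Only the smooth factor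
  \<open>a\<close> depends on \<open>z\<close>, and the integrand is continuous on a box, so differentiation under the
  integral sign applies without any integrability estimates.\<close>

definition averaged ::
  "('b::euclidean_space \<Rightarrow> complex) \<Rightarrow> ('b \<Rightarrow> 'a::euclidean_space) \<Rightarrow> 'b \<Rightarrow> 'b
    \<Rightarrow> ('a \<Rightarrow> complex) \<Rightarrow> 'a \<Rightarrow> complex" where
  "averaged q \<gamma> l u a z = integral (cbox l u) (\<lambda>p. q p * a (z - \<gamma> p))"

lemma averaged_continuous:
  fixes q :: "'b::euclidean_space \<Rightarrow> complex" and \<gamma> :: "'b \<Rightarrow> 'a::euclidean_space"
  assumes "continuous_on UNIV q" "continuous_on UNIV \<gamma>" "continuous_on UNIV a"
  shows "continuous_on S (\<lambda>p. q p * a (z - \<gamma> p))"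
proof -
  have "continuous_on UNIV (\<lambda>p. a (z - \<gamma> p))"
    by (rule continuous_on_compose2[OF assms(3) continuous_on_diff[OF continuous_on_const assms(2)]]) auto
  then have "continuous_on UNIV (\<lambda>p. q p * a (z - \<gamma> p))"
    using assms by (intro continuous_intros)
  then show ?thesis using continuous_on_subset by blast
qed

lemma averaged_has_derivative:
  fixes q :: "'b::euclidean_space \<Rightarrow> complex" and \<gamma> :: "'b \<Rightarrow> 'a::euclidean_space"
  assumes q: "continuous_on UNIV q" and \<gamma>: "continuous_on UNIV \<gamma>" and a: "smooth_on UNIV a"
  shows "(averaged q \<gamma> l u a has_derivative (\<lambda>v. averaged q \<gamma> l u (\<lambda>x. frechet_derivative a (at x) v) z)) (at z)"
proof -
  define F where "F x p = blinfun_mult_right (q p) o\<^sub>L Blinfun (frechet_derivative a (at (x - \<gamma> p)))" for x p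
  have ap: "blinfun_apply (F x p) v = q p * frechet_derivative a (at (x - \<gamma> p)) v" for x p v
    using smooth_on_has_derivative[OF a, of "x - \<gamma> p"]
    by (simp add: F_def bounded_linear_Blinfun_apply has_derivative_bounded_linear)
  have cF: "continuous_on S (\<lambda>(x, p). F x p)" for S
  proof -
    have "continuous_on UNIV (\<lambda>y. Blinfun (frechet_derivative a (at (fst y - \<gamma> (snd y)))))"
      by (rule continuous_on_compose2[OF smooth_on_continuous_blinfun[OF a]])
         (auto intro!: continuous_intros continuous_on_compose2[OF \<gamma>])
    moreover have "continuous_on UNIV (\<lambda>y::'a \<times> 'b. blinfun_mult_right (q (snd y)))"
      by (intro bounded_linear.continuous_on[OF bounded_linear_blinfun_mult_right] continuous_on_compose2[OF q] continuous_intros) auto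
    ultimately have "continuous_on UNIV (\<lambda>(x, p). F x p)"
      unfolding F_def case_prod_beta by (intro bounded_bilinear.continuous_on[OF bounded_bilinear_blinfun_compose])
    then show ?thesis using continuous_on_subset by blast
  qed
  have cF1: "continuous_on S (F x)" for S x
  proof -
    have "continuous_on S (Pair x)" by (intro continuous_on_Pair continuous_on_const continuous_on_id)
    from continuous_on_compose2[OF cF[of UNIV] this] show ?thesis by simp
  qed
  have "((\<lambda>x. integral (cbox l u) (\<lambda>p. q p * a (x - \<gamma> p))) has_derivative blinfun_apply (integral (cbox l u) (F z))) (at z within UNIV)"
  proof (rule leibniz_rule)
    show "((\<lambda>x. q p * a (x - \<gamma> p)) has_derivative blinfun_apply (F x p)) (at x within UNIV)" for x p
    proof -
      have "((\<lambda>x. a (x - \<gamma> p)) has_derivative (\<lambda>v. frechet_derivative a (at (x - \<gamma> p)) v)) (at x)"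
      proof -
        have "((\<lambda>x. x - \<gamma> p) has_derivative (\<lambda>v. v)) (at x)"
          by (auto intro!: derivative_eq_intros)
        from diff_chain_at[OF this smooth_on_has_derivative[OF a, of "x - \<gamma> p"]] show ?thesis
          by (simp add: o_def)
      qed
      then show ?thesis
        by (auto simp: ap intro!: derivative_eq_intros)
    qed
  qed (use cF averaged_continuous[OF q \<gamma> smooth_on_continuous_on[OF a]] in \<open>auto intro!: integrable_continuous\<close>)
  moreover have "blinfun_apply (integral (cbox l u) (F z)) = (\<lambda>v. averaged q \<gamma> l u (\<lambda>x. frechet_derivative a (at x) v) z)"
    by (rule ext, subst blinfun_apply_integral) (auto simp: ap averaged_def intro!: integrable_continuous cF1)
  moreover have "averaged q \<gamma> l u a = (\<lambda>x. integral (cbox l u) (\<lambda>p. q p * a (x - \<gamma> p)))"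
    by (simp add: averaged_def fun_eq_iff)
  ultimately show ?thesis by simp
qed

lemma smooth_on_averaged:
  assumes q: "continuous_on UNIV q" and \<gamma>: "continuous_on UNIV \<gamma>" and a: "smooth_on UNIV a"
  shows "smooth_on UNIV (averaged q \<gamma> l u a)"
  unfolding smooth_on_def
proof
  fix k
  show "ck_on k UNIV (averaged q \<gamma> l u a)"
    using a
  proof (induction k arbitrary: a)
    case 0
    then show ?case
      using averaged_has_derivative[OF q \<gamma> 0]
      by (auto intro!: has_derivative_continuous_on)
  next
    case (Suc k)
    have "ck_on k UNIV (\<lambda>x. frechet_derivative (averaged q \<gamma> l u a) (at x) v)" for v
      unfolding frechet_derivative_eqI[OF averaged_has_derivative[OF q \<gamma> Suc.prems]]
      by (rule Suc.IH[OF smooth_on_frechet[OF Suc.prems]])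
    moreover have "averaged q \<gamma> l u a differentiable (at x)" for x
      by (rule differentiableI[OF averaged_has_derivative[OF q \<gamma> Suc.prems]])
    ultimately show ?case by simp
  qed
qed

lemma wirt_gen_averaged:
  assumes q: "continuous_on UNIV q" and \<gamma>: "continuous_on UNIV \<gamma>" and a: "smooth_on UNIV a"
  shows "wirt_gen c j (averaged q \<gamma> l u a) z = averaged q \<gamma> l u (wirt_gen c j a) z"
proof -
  let ?A = "\<lambda>v p. q p * frechet_derivative a (at (z - \<gamma> p)) v"
  have i: "?A v integrable_on cbox l u" for v
    by (intro integrable_continuous averaged_continuous[OF q \<gamma> smooth_on_continuous_on[OF smooth_on_frechet[OF a]]])
  have "averaged q \<gamma> l u (wirt_gen c j a) z = integral (cbox l u) (\<lambda>p. (?A (axis j 1) p + c * ?A (axis j \<i>) p) / 2)"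
    unfolding averaged_def wirt_gen_def by (intro integral_cong) (simp add: algebra_simps)
  also have "\<dots> = (integral (cbox l u) (?A (axis j 1)) + c * integral (cbox l u) (?A (axis j \<i>))) / 2"
    using integral_add[OF i integrable_on_mult_right[OF i], of "axis j 1" c "axis j \<i>"] by simp
  also have "\<dots> = wirt_gen c j (averaged q \<gamma> l u a) z"
    unfolding wirt_gen_def frechet_derivative_eqI[OF averaged_has_derivative[OF q \<gamma> a]] averaged_def ..
  finally show ?thesis ..
qed

text \<open>The Cauchy transform in \<open>z\<^sub>1\<close>, the convolution with \<open>1 / (\<pi> \<zeta>)\<close>, cut off at \<open>|\<zeta>| = R\<close> and
  written in polar coordinates \<open>\<zeta> = r cis \<theta>\<close>: the Jacobian \<open>r\<close> cancels the singularity of the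
  kernel and leaves the smooth weight \<open>cis (- \<theta>) / \<pi>\<close>.\<close>

definition cauchy_transform :: "real \<Rightarrow> (complex ^ 2 \<Rightarrow> complex) \<Rightarrow> complex ^ 2 \<Rightarrow> complex" where
  "cauchy_transform R = averaged (\<lambda>p. cis (- snd p) / pi) (\<lambda>p. axis 1 (of_real (fst p) * cis (snd p))) (0, 0) (R, 2 * pi)"

lemma cauchy_transform_continuous:
  "continuous_on S (\<lambda>p::real \<times> real. cis (- snd p) / pi)"
  "continuous_on S (\<lambda>p::real \<times> real. axis 1 (of_real (fst p) * cis (snd p)) :: complex^2)"
  by (auto intro!: continuous_intros bounded_linear.continuous_on[OF bounded_linear_axis])

text \<open>The Cauchy-Pompeiu formula for compact support in \<open>z\<^sub>1\<close>. In polar coordinates \<open>\<partial>/\<partial>(cnj \<zeta>)\<close> equals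
  \<open>cis \<theta> / 2\<close> times \<open>\<partial>\<^sub>r + (\<i> / r) \<partial>\<^sub>\<theta>\<close>. The radial part \<open>E1\<close> integrates along each ray to
  \<open>- b z\<close>, because the outer end point lies outside the support, and the angular part
  \<open>E2\<close> integrates to zero over each circle by periodicity.\<close>

lemma cauchy_transform_wirt_bar1:
  assumes b: "smooth_on UNIV b"
    and supp: "\<And>x. norm (x $ 1) \<ge> M \<Longrightarrow> b x = 0"
    and z: "norm (z $ 1) + M \<le> R" and "R > 0"
  shows "cauchy_transform R (wirt_bar 1 b) z = b z"
proof -
  define p where "p r \<theta> = z - axis 1 (of_real r * cis \<theta>)" for r \<theta>
  define Db where "Db r \<theta> v = frechet_derivative b (at (p r \<theta>)) v" for r \<theta> v
  define E1 where "E1 r \<theta> = Db r \<theta> (axis 1 (- cis \<theta>))" for r \<theta>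
  define E2 where "E2 r \<theta> = Db r \<theta> (axis 1 (- (\<i> * cis \<theta>)))" for r \<theta>
  note Dd = smooth_on_has_derivative[OF b UNIV_I]
  have ax: "axis 1 (c * a) = Re c *\<^sub>R axis 1 a + Im c *\<^sub>R (axis 1 (\<i> * a) :: complex^2)" for c a
    by (simp add: vec_eq_iff axis_def complex_eq_iff)
  have Dlin: "Db r \<theta> (axis 1 c) = Re c *\<^sub>R Db r \<theta> (axis 1 1) + Im c *\<^sub>R Db r \<theta> (axis 1 \<i>)" for r \<theta> c
    unfolding Db_def using ax[of c 1] has_derivative_bounded_linear[OF Dd] by (simp add: linear_simps)
  have E1: "E1 r \<theta> = - (cos \<theta> *\<^sub>R Db r \<theta> (axis 1 1) + sin \<theta> *\<^sub>R Db r \<theta> (axis 1 \<i>))" for r \<theta>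
    unfolding E1_def by (subst Dlin) simp
  have E2: "E2 r \<theta> = sin \<theta> *\<^sub>R Db r \<theta> (axis 1 1) - cos \<theta> *\<^sub>R Db r \<theta> (axis 1 \<i>)" for r \<theta>
    unfolding E2_def by (subst Dlin) simp
  have cp: "continuous_on S (\<lambda>y. p (fst y) (snd y))" for S
    unfolding p_def by (auto intro!: continuous_intros bounded_linear.continuous_on[OF bounded_linear_axis])
  have cDb: "continuous_on S (\<lambda>y. Db (fst y) (snd y) v)" for S v
    unfolding Db_def
    by (rule continuous_on_compose2[OF smooth_on_continuous_on[OF smooth_on_frechet[OF b]] cp]) auto
  have cE1: "continuous_on S (\<lambda>(r,\<theta>). E1 r \<theta>)" and cE2: "continuous_on S (\<lambda>(r,\<theta>). E2 r \<theta>)" for S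
    unfolding case_prod_beta E1 E2 by (intro continuous_intros cDb)+
  have pr: "((\<lambda>r. p r \<theta>) has_vector_derivative axis 1 (- cis \<theta>)) (at r within S)" for r \<theta> S
  proof -
    have "((\<lambda>r. axis 1 (of_real r * cis \<theta>)) has_vector_derivative axis 1 (cis \<theta>)) (at r within S)"
      by (rule bounded_linear.has_vector_derivative[OF bounded_linear_axis])
         (auto intro!: derivative_eq_intros simp: has_vector_derivative_def scaleR_conv_of_real)
    then show ?thesis
      unfolding p_def by (auto intro!: derivative_eq_intros simp: vec_eq_iff axis_def)
  qed
  have pt: "((\<lambda>\<theta>. p r \<theta>) has_vector_derivative axis 1 (of_real r * (- (\<i> * cis \<theta>)))) (at \<theta> within S)" for r \<theta> S
  proof -
    have "((\<lambda>\<theta>. axis 1 (of_real r * cis \<theta>)) has_vector_derivative axis 1 (of_real r * (\<i> * cis \<theta>))) (at \<theta> within S)"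
      by (rule bounded_linear.has_vector_derivative[OF bounded_linear_axis])
         (auto intro!: derivative_eq_intros simp: has_vector_derivative_def scaleR_conv_of_real)
    then show ?thesis
      unfolding p_def by (auto intro!: derivative_eq_intros simp: vec_eq_iff axis_def)
  qed
  note chain = smooth_on_along_curve[OF b UNIV_I]
  have radial: "integral {0..R} (\<lambda>r. E1 r \<theta>) = - b z" for \<theta>
  proof -
    have ftc: "((\<lambda>r. E1 r \<theta>) has_integral (b (p R \<theta>) - b (p 0 \<theta>))) {0..R}"
      unfolding E1_def Db_def
      by (rule fundamental_theorem_of_calculus) (use \<open>R > 0\<close> in \<open>auto intro!: chain pr\<close>)
    have "b (p R \<theta>) = 0"
    proof (rule supp)
      have "R \<le> norm (z $ 1) + norm (z $ 1 - of_real R * cis \<theta>)"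
        using norm_triangle_ineq4[of "z $ 1" "z $ 1 - of_real R * cis \<theta>"] \<open>R > 0\<close> by (simp add: norm_mult)
      then show "M \<le> norm (p R \<theta> $ 1)" using z by (simp add: p_def axis_def)
    qed
    moreover have "p 0 \<theta> = z" by (simp add: p_def vec_eq_iff axis_def)
    ultimately show ?thesis using integral_unique[OF ftc] by simp
  qed
  have angular: "integral {0..2*pi} (E2 r) = 0" if "r > 0" for r
  proof -
    have Db: "Db r \<theta> (axis 1 (of_real r * - (\<i> * cis \<theta>))) = r *\<^sub>R E2 r \<theta>" for \<theta>
      unfolding E2_def by (subst (1 2) Dlin) (simp add: scaleR_conv_of_real algebra_simps)
    have "((\<lambda>\<theta>. b (p r \<theta>)) has_vector_derivative r *\<^sub>R E2 r \<theta>) (at \<theta> within S)" for \<theta> S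
      using chain[OF pt, of r \<theta> S] by (simp only: Db_def[symmetric] Db)
    then have ftc: "((\<lambda>\<theta>. r *\<^sub>R E2 r \<theta>) has_integral (b (p r (2*pi)) - b (p r 0))) {0..2*pi}"
      by (intro fundamental_theorem_of_calculus) auto
    have "p r (2*pi) = p r 0" by (simp add: p_def)
    then show ?thesis using integral_unique[OF ftc] that by simp
  qed
  have I1: "integral (cbox (0,0) (R,2*pi)) (\<lambda>(r,\<theta>). E1 r \<theta>) = - (2 * pi * b z)"
  proof -
    have "integral (cbox (0,0) (R,2*pi)) (\<lambda>(r,\<theta>). E1 r \<theta>)
        = integral (cbox 0 R) (\<lambda>r. integral (cbox 0 (2*pi)) (E1 r))"
      by (simp add: integral_prod_continuous[OF cE1])
    also have "\<dots> = integral (cbox 0 (2*pi)) (\<lambda>\<theta>. integral (cbox 0 R) (\<lambda>r. E1 r \<theta>))"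
      by (rule integral_swap_continuous[OF cE1])
    also have "\<dots> = integral (cbox 0 (2*pi)) (\<lambda>\<theta>::real. - b z)"
      by (simp add: radial cbox_interval)
    also have "\<dots> = - (2 * pi * b z)" by (simp add: scaleR_conv_of_real)
    finally show ?thesis .
  qed
  have I2: "integral (cbox (0,0) (R,2*pi)) (\<lambda>(r,\<theta>). E2 r \<theta>) = 0"
  proof -
    have "integral (cbox (0,0) (R,2*pi)) (\<lambda>(r,\<theta>). E2 r \<theta>)
        = integral (cbox 0 R) (\<lambda>r. integral (cbox 0 (2*pi)) (E2 r))"
      by (simp add: integral_prod_continuous[OF cE2])
    also have "\<dots> = integral (cbox 0 R) (\<lambda>r. 0)"
      \<comment> \<open>for \<open>r = 0\<close> the angular derivative gives no information, but one radius is negligible\<close>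
      by (rule integral_spike[of "{0}"]) (auto simp: angular cbox_interval)
    finally show ?thesis by simp
  qed
  have "cis (- \<theta>) / pi * wirt_bar 1 b (p r \<theta>) = (- 1 / (2 * pi)) * (E1 r \<theta> + \<i> * E2 r \<theta>)" for r \<theta>
    unfolding wirt_bar_def E1 E2 Db_def[symmetric]
    by (simp add: cis.code complex_eq_iff scaleR_conv_of_real field_simps)
  then have "cauchy_transform R (wirt_bar 1 b) z
      = integral (cbox (0,0) (R,2*pi)) (\<lambda>y. (- 1 / (2 * pi)) * ((\<lambda>(r,\<theta>). E1 r \<theta>) y + \<i> * (\<lambda>(r,\<theta>). E2 r \<theta>) y))"
    unfolding cauchy_transform_def averaged_def p_def by (intro integral_cong) (simp add: case_prod_beta)
  also have "\<dots> = (- 1 / (2 * pi)) * (integral (cbox (0,0) (R,2*pi)) (\<lambda>(r,\<theta>). E1 r \<theta>) + \<i> * integral (cbox (0,0) (R,2*pi)) (\<lambda>(r,\<theta>). E2 r \<theta>))"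
    by (simp only: integral_mult_right
        integral_add[OF integrable_continuous[OF cE1] integrable_on_mult_right[OF integrable_continuous[OF cE2]]])
  also have "\<dots> = b z" unfolding I1 I2 by simp
  finally show ?thesis .
qed

section \<open>Potentials with compact support\<close>

text \<open>The identity theorem in one variable, applied on the complex line through \<open>a\<close> in direction \<open>b\<close>.\<close>

lemma dbar_closed_slice_zero:
  fixes f :: "complex ^ 'n::finite \<Rightarrow> complex" and a b :: "complex ^ 'n"
  assumes S: "open S" "connected S" and U: "open U" "U \<noteq> {}" "U \<subseteq> S"
    and f: "\<And>s. s \<in> S \<Longrightarrow> f differentiable (at (\<chi> i. a $ i + s * b $ i))"
    and dbar: "\<And>s j. s \<in> S \<Longrightarrow> wirt_bar j f (\<chi> i. a $ i + s * b $ i) = 0"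
    and zero: "\<And>s. s \<in> U \<Longrightarrow> f (\<chi> i. a $ i + s * b $ i) = 0" and s: "s \<in> S"
  shows "f (\<chi> i. a $ i + s * b $ i) = 0"
proof -
  have "(\<lambda>s. f (\<chi> i. a $ i + s * b $ i)) field_differentiable at s" if "s \<in> S" for s
    by (rule dbar_closed_field_differentiable[where \<gamma> = "\<lambda>s. \<chi> i. a $ i + s * b $ i" and \<gamma>' = "\<lambda>i. b $ i"])
       (auto intro!: derivative_eq_intros f[OF that] dbar[OF that])
  then have "(\<lambda>s. f (\<chi> i. a $ i + s * b $ i)) holomorphic_on S"
    unfolding holomorphic_on_def using field_differentiable_at_within by blast
  from analytic_continuation_open[OF U(1) S(1) U(2) S(2) U(3) this holomorphic_on_const[of 0] _ s] zero
  show ?thesis by simp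
qed

lemma slice1: "(\<chi> i. axis 2 (z $ 2) $ i + s * axis 1 1 $ i) = (vector [s, z $ 2] :: complex ^ 2)"
  by (simp add: vec_eq_iff forall_2 axis_def)

lemma slice2: "(\<chi> i. axis 1 (z $ 1) $ i + s * axis 2 1 $ i) = (vector [z $ 1, s] :: complex ^ 2)"
  by (simp add: vec_eq_iff forall_2 axis_def)

lemma vector_eta_2: "vector [z $ 1, z $ 2] = (z :: 'a::zero ^ 2)"
  by (simp add: vec_eq_iff forall_2)

lemma open_far: "open {s :: complex. norm s > M}"
  by (intro open_Collect_less continuous_intros)

lemma far_nonempty: "{s :: complex. norm s > M} \<noteq> {}"
proof -
  have "of_real (\<bar>M\<bar> + 1) \<in> {s :: complex. norm s > M}" by (simp add: norm_of_real del: of_real_add)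
  then show ?thesis by blast
qed

lemma dbar_closed_line_zero:
  fixes f :: "complex ^ 2 \<Rightarrow> complex"
  assumes f: "smooth_on UNIV f" and dbar: "\<And>s j. wirt_bar j f (vector [z $ 1, s]) = 0"
    and zero: "\<And>s. norm s > M \<Longrightarrow> f (vector [z $ 1, s]) = 0"
  shows "f z = 0"
proof -
  have "f (\<chi> i. axis 1 (z $ 1) $ i + z $ 2 * axis 2 1 $ i) = 0"
    by (rule dbar_closed_slice_zero[OF open_UNIV connected_UNIV open_far far_nonempty subset_UNIV])
       (use zero dbar in \<open>auto simp: slice2 smooth_on_differentiable[OF f]\<close>)
  then show ?thesis by (simp add: slice2 vector_eta_2)
qed

lemma open_norm_nth: "open {z :: complex ^ 2. norm (z $ 1) < r}" "open {z :: complex ^ 2. norm (z $ 1) > r}"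
  by (intro open_Collect_less continuous_intros)+

text \<open>In dimension two the \<open>\<partial>\<close>-bar equation with compact support has a solution with compact support.
  The Cauchy transform in \<open>z\<^sub>1\<close> solves both equations, the second because it commutes with
  \<open>\<partial>/\<partial>(cnj z\<^sub>2)\<close> and the data are closed. It vanishes with the data for large \<open>z\<^sub>2\<close>; for fixed
  \<open>z\<^sub>1\<close> outside the support it is entire in \<open>z\<^sub>2\<close>, hence zero. The truncated transform is correct
  only for \<open>|z\<^sub>1| \<le> 2 M\<close>, so it is continued by zero from the shell \<open>M < |z\<^sub>1| < 2 M\<close>,
  on which it already vanishes.\<close>

lemma dbar_compact_support_solution:
  fixes a1 a2 :: "complex ^ 2 \<Rightarrow> complex"
  assumes a1: "smooth_on UNIV a1" and a2: "smooth_on UNIV a2" and M: "M > 0"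
    and supp1: "\<And>z. norm (z $ 1) \<ge> M \<or> norm (z $ 2) \<ge> M \<Longrightarrow> a1 z = 0"
    and supp2: "\<And>z. norm (z $ 1) \<ge> M \<or> norm (z $ 2) \<ge> M \<Longrightarrow> a2 z = 0"
    and closed: "\<And>z. wirt_bar 2 a1 z = wirt_bar 1 a2 z"
  obtains g where "smooth_on UNIV g" "\<And>z. norm (z $ 1) > M \<or> norm (z $ 2) \<ge> M \<Longrightarrow> g z = 0"
    "\<And>z. wirt_bar 1 g z = a1 z" "\<And>z. wirt_bar 2 g z = a2 z"
proof -
  define h where "h = cauchy_transform (3 * M) a1"
  define g where "g z = (if norm (z $ 1) < 2 * M then h z else 0)" for z
  have smh: "smooth_on UNIV h"
    unfolding h_def cauchy_transform_def
    by (rule smooth_on_averaged[OF cauchy_transform_continuous a1])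
  have comm: "wirt_bar j h z = cauchy_transform (3 * M) (wirt_bar j a1) z" for j z
    unfolding wirt_bar_eq_gen h_def cauchy_transform_def
    by (rule wirt_gen_averaged[OF cauchy_transform_continuous a1])
  have h1: "wirt_bar 1 h z = a1 z" if "norm (z $ 1) \<le> 2 * M" for z
    unfolding comm by (rule cauchy_transform_wirt_bar1[OF a1, of M]) (use supp1 that M in auto)
  have h2: "wirt_bar 2 h z = a2 z" if "norm (z $ 1) \<le> 2 * M" for z
  proof -
    have "wirt_bar 2 a1 = wirt_bar 1 a2" using closed by (simp add: fun_eq_iff)
    then show ?thesis
      unfolding comm using cauchy_transform_wirt_bar1[OF a2, of M z "3 * M"] supp2 that M by auto
  qed
  have h0: "h z = 0" if "norm (z $ 2) \<ge> M" for z
  proof -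
    have "a1 (z - axis 1 c) = 0" for c
      by (rule supp1) (use that in \<open>simp add: axis_def\<close>)
    then show ?thesis by (simp add: h_def cauchy_transform_def averaged_def)
  qed
  have hM: "h z = 0" if "M \<le> norm (z $ 1)" "norm (z $ 1) \<le> 2 * M" for z
  proof (rule dbar_closed_line_zero[OF smh, of z M])
    fix s :: complex and j :: 2
    have "j = 1 \<or> j = 2" using exhaust_2 by blast
    then show "wirt_bar j h (vector [z $ 1, s]) = 0"
      using h1[of "vector [z $ 1, s]"] h2[of "vector [z $ 1, s]"]
        supp1[of "vector [z $ 1, s]"] supp2[of "vector [z $ 1, s]"] that by auto
  qed (auto intro: h0)
  let ?A = "{z :: complex ^ 2. norm (z $ 1) < 2 * M}" and ?B = "{z :: complex ^ 2. norm (z $ 1) > M}"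
  have gA: "h z = g z" if "z \<in> ?A" for z using that by (simp add: g_def)
  have gB: "0 = g z" if "z \<in> ?B" for z using that hM[of z] by (simp add: g_def)
  have AB: "?A \<union> ?B = UNIV" using M by force
  have "smooth_on (?A \<union> ?B) g"
    by (intro smooth_on_open_Un open_norm_nth smooth_on_cong[OF open_norm_nth(1) gA smooth_on_subset[OF smh]]
        smooth_on_cong[OF open_norm_nth(2) gB smooth_on_const]) auto
  moreover have "g z = 0" if "norm (z $ 1) > M \<or> norm (z $ 2) \<ge> M" for z
    using that gB[of z] h0[of z] by (auto simp: g_def)
  moreover have "wirt_bar j g z = (if j = 1 then a1 z else a2 z)" for j :: 2 and z
  proof -
    have j: "j = 1 \<or> j = 2" using exhaust_2 by blast
    show ?thesis
    proof (cases "z \<in> ?A")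
      case True
      then have "wirt_bar j h z = wirt_bar j g z" using gA by (intro wirt_bar_cong[OF open_norm_nth(1)])
      then show ?thesis using j h1[of z] h2[of z] True by auto
    next
      case False
      then have "z \<in> ?B" using AB by blast
      then have "wirt_bar j (\<lambda>z. 0) z = wirt_bar j g z" using gB by (intro wirt_bar_cong[OF open_norm_nth(2)])
      then show ?thesis using supp1[of z] supp2[of z] \<open>z \<in> ?B\<close> by (auto simp: wirt_zero)
    qed
  qed
  ultimately show ?thesis using AB by (intro that[of g]) auto
qed

text \<open>For fixed \<open>z\<^sub>2\<close> the tube is a strip in the \<open>z\<^sub>1\<close>-plane. It is connected and leaves every compact
  set, so a function that is holomorphic on the tube and zero for large \<open>z\<^sub>1\<close> vanishes there.\<close>

lemma dbar_closed_tube_zero: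
  fixes f :: "complex ^ 2 \<Rightarrow> complex"
  assumes f: "smooth_on UNIV f" and supp: "\<And>z. norm (z $ 1) > M \<Longrightarrow> f z = 0"
    and dbar: "\<And>z j. \<bar>Im (z $ 1)\<bar> < \<epsilon> \<Longrightarrow> \<bar>Im (z $ 2)\<bar> < \<epsilon> \<Longrightarrow> wirt_bar j f z = 0"
    and z: "\<bar>Im (z $ 1)\<bar> < \<epsilon>" "\<bar>Im (z $ 2)\<bar> < \<epsilon>"
  shows "f z = 0"
proof -
  let ?S = "{s :: complex. - \<epsilon> < Im s} \<inter> {s. Im s < \<epsilon>}"
  let ?U = "?S \<inter> {s. norm s > M}"
  have S: "open ?S" "connected ?S"
    by (auto intro!: open_Int open_halfspace_Im_gt open_halfspace_Im_lt convex_connected convex_Int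
        convex_halfspace_Im_gt convex_halfspace_Im_lt)
  have "\<epsilon> > 0" "M < \<bar>M\<bar> + 1" using z by linarith+
  then have "of_real (\<bar>M\<bar> + 1) \<in> ?U" by (simp add: norm_of_real del: of_real_add)
  then have U: "open ?U" "?U \<noteq> {}" "?U \<subseteq> ?S" using S open_far by blast+
  have "f (\<chi> i. axis 2 (z $ 2) $ i + z $ 1 * axis 1 1 $ i) = 0"
    by (rule dbar_closed_slice_zero[OF S U])
       (use supp dbar z in \<open>auto simp: slice1 smooth_on_differentiable[OF f]\<close>)
  then show ?thesis by (simp add: slice1 vector_eta_2)
qed

lemma wirt_bar_cnj: "smooth_on UNIV f \<Longrightarrow> wirt_bar j (\<lambda>z. cnj (f z)) z = cnj (wirt j f z)"
  using wirt_gen_cnj[of f z "-\<i>" j] smooth_on_differentiable[of UNIV f z]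
  by (simp add: wirt_eq_gen wirt_bar_eq_gen)

lemma wirt_wirt_bar_commute:
  "open X \<Longrightarrow> smooth_on X f \<Longrightarrow> z \<in> X \<Longrightarrow> wirt i (wirt_bar j f) z = wirt_bar j (wirt i f) z"
  unfolding wirt_eq_gen wirt_bar_eq_gen by (rule wirt_gen_commute)

text \<open>First solve \<open>\<partial>\<close>-bar row by row, obtaining \<open>g i\<close> with \<open>\<partial>(g i)/\<partial>(cnj z\<^sub>j) = a i j\<close>. The difference
  \<open>\<partial>(g 1)/\<partial>z\<^sub>2 - \<partial>(g 2)/\<partial>z\<^sub>1\<close> is holomorphic with compact support, hence zero; conjugating turns
  this into the closedness needed to solve \<open>\<partial>f/\<partial>z\<^sub>i = g i\<close>. On a tube around the real plane where
  the data vanish, first each \<open>g i\<close> and then \<open>cnj f\<close> is holomorphic, hence zero: this keeps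
  the support of \<open>f\<close> away from the real plane.\<close>

lemma ddbar_compact_support_solution:
  fixes a :: "2 \<Rightarrow> 2 \<Rightarrow> complex ^ 2 \<Rightarrow> complex"
  assumes a: "\<And>i j. smooth_on UNIV (a i j)" and M: "M > 0"
    and supp: "\<And>i j z. norm (z $ 1) \<ge> M \<or> norm (z $ 2) \<ge> M \<Longrightarrow> a i j z = 0"
    and dbar: "\<And>i z. wirt_bar 2 (a i 1) z = wirt_bar 1 (a i 2) z"
    and del: "\<And>j z. wirt 2 (a 1 j) z = wirt 1 (a 2 j) z"
    and tube: "\<And>i j z. \<bar>Im (z $ 1)\<bar> < \<epsilon> \<Longrightarrow> \<bar>Im (z $ 2)\<bar> < \<epsilon> \<Longrightarrow> a i j z = 0"
  obtains f where "smooth_on UNIV f" "\<And>z. norm (z $ 1) > M + 1 \<or> norm (z $ 2) > M + 1 \<Longrightarrow> f z = 0"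
    "\<And>i j z. wirt i (wirt_bar j f) z = a i j z"
    "\<And>z. \<bar>Im (z $ 1)\<bar> < \<epsilon> \<Longrightarrow> \<bar>Im (z $ 2)\<bar> < \<epsilon> \<Longrightarrow> f z = 0"
proof -
  have "\<exists>g. smooth_on UNIV g \<and> (\<forall>z. norm (z $ 1) > M \<or> norm (z $ 2) \<ge> M \<longrightarrow> g z = 0) \<and> (\<forall>j z. wirt_bar j g z = a i j z)" for i
  proof -
    obtain g where "smooth_on UNIV g" "\<And>z. norm (z $ 1) > M \<or> norm (z $ 2) \<ge> M \<Longrightarrow> g z = 0"
      "\<And>z. wirt_bar 1 g z = a i 1 z" "\<And>z. wirt_bar 2 g z = a i 2 z"
      using dbar_compact_support_solution[OF a[of i 1] a[of i 2] M supp supp dbar] by metis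
    then show ?thesis by (intro exI[of _ g]) (auto simp: forall_2)
  qed
  then obtain g where g: "\<And>i. smooth_on UNIV (g i)"
    and suppg: "\<And>i z. norm (z $ 1) > M \<or> norm (z $ 2) \<ge> M \<Longrightarrow> g i z = 0"
    and dg: "\<And>i j z. wirt_bar j (g i) z = a i j z"
    by metis
  have dg': "wirt_bar j (g i) = a i j" for i j using dg by (simp add: fun_eq_iff)
  have wg: "smooth_on UNIV (wirt i (g j))" for i j using g by (intro smooth_on_wirt) auto
  have gtube: "g i z = 0" if "\<bar>Im (z $ 1)\<bar> < \<epsilon>" "\<bar>Im (z $ 2)\<bar> < \<epsilon>" for i z
    by (rule dbar_closed_tube_zero[OF g, of M]) (use suppg tube that in \<open>auto simp: dg\<close>)
  have dz: "wirt i (g j) z = 0" if "norm (z $ 1) > M \<or> norm (z $ 2) > M" for i j z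
  proof -
    let ?O = "{z :: complex ^ 2. norm (z $ 1) > M} \<union> {z. norm (z $ 2) > M}"
    have O: "open ?O" by (intro open_Un open_Collect_less continuous_intros)
    have "wirt i (g j) z = wirt i (\<lambda>z. 0) z"
      by (rule wirt_cong[OF O]) (use that suppg in \<open>auto simp: less_imp_le\<close>)
    then show ?thesis by (simp add: wirt_zero)
  qed
  have sym: "wirt 2 (g 1) z = wirt 1 (g 2) z" for z
  proof -
    have "wirt 2 (g 1) z - wirt 1 (g 2) z = 0"
    proof (rule dbar_closed_line_zero[of "\<lambda>z. wirt 2 (g 1) z - wirt 1 (g 2) z" z M])
      show "smooth_on UNIV (\<lambda>z. wirt 2 (g 1) z - wirt 1 (g 2) z)"
        by (intro smooth_on_diff wg) auto
      fix s :: complex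
      show "wirt_bar j (\<lambda>z. wirt 2 (g 1) z - wirt 1 (g 2) z) (vector [z $ 1, s]) = 0" for j
      proof -
        let ?p = "vector [z $ 1, s] :: complex ^ 2"
        have "wirt_bar j (\<lambda>z. wirt 2 (g 1) z - wirt 1 (g 2) z) ?p
            = wirt_bar j (wirt 2 (g 1)) ?p - wirt_bar j (wirt 1 (g 2)) ?p"
          unfolding wirt_bar_eq_gen by (rule wirt_gen_diff) (auto intro!: smooth_on_differentiable[OF wg])
        also have "\<dots> = wirt 2 (a 1 j) ?p - wirt 1 (a 2 j) ?p"
          by (simp add: wirt_wirt_bar_commute[OF open_UNIV g UNIV_I, symmetric] dg')
        finally show ?thesis by (simp add: del)
      qed
      show "wirt 2 (g 1) (vector [z $ 1, s]) - wirt 1 (g 2) (vector [z $ 1, s]) = 0" if "M < norm s"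
        using that by (simp add: dz)
    qed
    then show ?thesis by simp
  qed
  define c where "c i z = cnj (g i z)" for i z
  have c: "smooth_on UNIV (c i)" for i unfolding c_def using g by (intro smooth_on_cnj) auto
  have cc: "wirt_bar j (c i) z = cnj (wirt j (g i) z)" for i j z
    unfolding c_def by (rule wirt_bar_cnj[OF g])
  obtain f0 where f0: "smooth_on UNIV f0" "\<And>z. norm (z $ 1) > M + 1 \<or> norm (z $ 2) \<ge> M + 1 \<Longrightarrow> f0 z = 0"
      "\<And>z. wirt_bar 1 f0 z = c 1 z" "\<And>z. wirt_bar 2 f0 z = c 2 z"
  proof (rule dbar_compact_support_solution[OF c[of 1] c[of 2], of "M + 1"])
    show "wirt_bar 2 (c 1) z = wirt_bar 1 (c 2) z" for z by (simp add: cc sym)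
  qed (use M suppg in \<open>auto simp: c_def\<close>)
  have f0w: "wirt_bar j f0 z = c j z" for j z
    using exhaust_2[of j] f0(3,4) by auto
  define f where "f z = cnj (f0 z)" for z
  have f: "smooth_on UNIV f" unfolding f_def by (intro smooth_on_cnj f0) auto
  have "cnj (wirt i f z) = cnj (g i z)" for i z
    using wirt_bar_cnj[OF f, of i z] f0w[of i z] by (simp add: f_def c_def)
  then have wf: "wirt i f = g i" for i by (simp add: fun_eq_iff)
  show ?thesis
  proof (rule that[OF f])
    show "wirt i (wirt_bar j f) z = a i j z" for i j z
      by (simp add: wirt_wirt_bar_commute[OF open_UNIV f] wf dg)
    show "f z = 0" if "norm (z $ 1) > M + 1 \<or> norm (z $ 2) > M + 1" for z
      using f0(2)[of z] that by (auto simp: f_def)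
    show "f z = 0" if "\<bar>Im (z $ 1)\<bar> < \<epsilon>" "\<bar>Im (z $ 2)\<bar> < \<epsilon>" for z
    proof -
      have "f0 z = 0"
        by (rule dbar_closed_tube_zero[OF f0(1), of "M + 1"]) (use f0(2) that gtube in \<open>auto simp: f0w c_def\<close>)
      then show ?thesis by (simp add: f_def)
    qed
  qed
qed

section \<open>Vanishing of compactly supported Bott-Chern cohomology\<close>

lemma smooth_on_sum:
  "open X \<Longrightarrow> (\<And>i. i \<in> I \<Longrightarrow> smooth_on X (f i)) \<Longrightarrow> smooth_on X (\<lambda>x. \<Sum>i\<in>I. f i x)"
  by (induction I rule: infinite_finite_induct) (auto simp: smooth_on_const intro: smooth_on_add)

lemma form_smooth: "\<omega> \<in> forms p q X \<Longrightarrow> smooth_on X (\<omega> I J)"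
  by (simp add: forms_def)

lemma smooth_on_delbar:
  assumes "open X" "\<And>I J. smooth_on X (\<omega> I J)"
  shows "smooth_on X (delbar X \<omega> I J)"
proof (rule smooth_on_cong[OF assms(1)])
  show "smooth_on X (\<lambda>z. \<Sum>j\<in>J. (-1) ^ (card I + card {k \<in> J. k < j}) * wirt_bar j (\<omega> I (J - {j})) z)"
    by (intro smooth_on_sum smooth_on_mult smooth_on_const smooth_on_wirt_bar assms)
qed (simp add: delbar_def)

lemma del_diff:
  assumes "\<And>I J. smooth_on X (\<omega> I J)" "\<And>I J. smooth_on X (\<eta> I J)"
  shows "del X (\<omega> - \<eta>) = del X \<omega> - del X \<eta>"
proof (intro ext)
  fix I J z
  show "del X (\<omega> - \<eta>) I J z = (del X \<omega> - del X \<eta>) I J z"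
  proof (cases "z \<in> X")
    case True
    have "wirt i (\<omega> I J - \<eta> I J) z = wirt i (\<omega> I J) z - wirt i (\<eta> I J) z" for i I J
      unfolding wirt_eq_gen fun_diff_def
      by (rule wirt_gen_diff) (rule smooth_on_differentiable[OF assms(1) True] smooth_on_differentiable[OF assms(2) True])+
    with True show ?thesis
      by (simp add: del_def right_diff_distrib sum_subtractf)
  qed (simp add: del_def)
qed

lemma delbar_diff:
  assumes "\<And>I J. smooth_on X (\<omega> I J)" "\<And>I J. smooth_on X (\<eta> I J)"
  shows "delbar X (\<omega> - \<eta>) = delbar X \<omega> - delbar X \<eta>"
proof (intro ext)
  fix I J z
  show "delbar X (\<omega> - \<eta>) I J z = (delbar X \<omega> - delbar X \<eta>) I J z"
  proof (cases "z \<in> X")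
    case True
    have "wirt_bar i (\<omega> I J - \<eta> I J) z = wirt_bar i (\<omega> I J) z - wirt_bar i (\<eta> I J) z" for i I J
      unfolding wirt_bar_eq_gen fun_diff_def
      by (rule wirt_gen_diff) (rule smooth_on_differentiable[OF assms(1) True] smooth_on_differentiable[OF assms(2) True])+
    with True show ?thesis
      by (simp add: delbar_def right_diff_distrib sum_subtractf)
  qed (simp add: delbar_def)
qed

lemma forms_c_diff:
  assumes X: "open X" and \<omega>: "\<omega> \<in> forms_c p q X" and \<eta>: "\<eta> \<in> forms_c p q X"
  shows "\<omega> - \<eta> \<in> forms_c p q X"
proof -
  have "\<omega> - \<eta> \<in> forms p q X"
    using assms by (auto simp: forms_c_def forms_def fun_diff_def zero_fun_def intro!: smooth_on_diff)
  moreover have "compact (form_support X (\<omega> - \<eta>))"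
  proof -
    let ?S = "\<lambda>\<omega>. {z \<in> X. \<exists>I J. \<omega> I J z \<noteq> 0}"
    have "?S (\<omega> - \<eta>) \<subseteq> ?S \<omega> \<union> ?S \<eta>" by (simp add: fun_diff_def subset_iff) (metis diff_0_right)
    then have "closure (?S (\<omega> - \<eta>)) \<subseteq> closure (?S \<omega>) \<union> closure (?S \<eta>)"
      unfolding closure_Un[symmetric] by (rule closure_mono)
    moreover have "C \<subseteq> A \<union> B \<Longrightarrow> X \<inter> C = (X \<inter> A \<union> X \<inter> B) \<inter> C" for A B C by blast
    ultimately have "form_support X (\<omega> - \<eta>) = (form_support X \<omega> \<union> form_support X \<eta>) \<inter> closure (?S (\<omega> - \<eta>))"
      unfolding form_support_def by simp
    moreover have "compact (form_support X \<omega> \<union> form_support X \<eta>)"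
      using \<omega> \<eta> by (auto simp: forms_c_def)
    ultimately show ?thesis by (simp add: compact_Int_closed)
  qed
  ultimately show ?thesis by (simp add: forms_c_def)
qed

lemma BC_coboundaries_c_diff:
  assumes "open X" "\<alpha> \<in> BC_coboundaries_c X" "\<beta> \<in> BC_coboundaries_c X"
  shows "\<alpha> - \<beta> \<in> BC_coboundaries_c X"
proof -
  obtain f g where f: "f \<in> forms_c 0 0 X" "\<alpha> = del X (delbar X f)"
    and g: "g \<in> forms_c 0 0 X" "\<beta> = del X (delbar X g)"
    using assms by (auto simp: BC_coboundaries_c_def)
  have s: "smooth_on X (f I J)" "smooth_on X (g I J)" for I J
    using f g by (auto simp: forms_c_def forms_def)
  have "del X (delbar X (f - g)) = \<alpha> - \<beta>"
    using s by (simp add: f g delbar_diff del_diff smooth_on_delbar[OF assms(1)])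
  then show ?thesis
    unfolding BC_coboundaries_c_def using forms_c_diff[OF assms(1) f(1) g(1)] by (metis imageI)
qed

text \<open>The support \<open>K\<close> of \<open>\<alpha>\<close> is compact and the real plane is closed, so some tube around the plane
  misses \<open>K\<close>. Extended by zero, the coefficients of \<open>\<alpha>\<close> are smooth on all of \<open>\<complex>\<^sup>2\<close>, and the potential
  with compact support in \<open>\<complex>\<^sup>2\<close> vanishes on the tube, so its support is compact in \<open>X\<close>.\<close>

lemma BC_cocycle_is_coboundary:
  fixes \<alpha> :: "2 form"
  assumes X: "X = UNIV - real_plane" and \<alpha>: "\<alpha> \<in> BC_cocycles_c X"
  shows "\<alpha> \<in> BC_coboundaries_c X"
proof -
  have oX: "open X" unfolding X using closed_real_plane by (simp add: open_Diff)
  define K where "K = form_support X \<alpha>"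
  have K: "compact K" and form: "\<alpha> \<in> forms 1 1 X"
    and del: "del X \<alpha> = 0" and delbar: "delbar X \<alpha> = 0"
    using \<alpha> unfolding BC_cocycles_c_def forms_c_def K_def by blast+
  have out: "\<alpha> I J z = 0" if "z \<notin> K" for I J z
  proof (cases "z \<in> X")
    case True
    then show ?thesis
      using that closure_subset[of "{z \<in> X. \<exists>I J. \<alpha> I J z \<noteq> 0}"] by (auto simp: K_def form_support_def)
  qed (use form in \<open>simp add: forms_def\<close>)
  have oK: "open (- K)" using K compact_imp_closed by auto
  have cov: "X \<union> - K = UNIV" by (auto simp: K_def form_support_def)
  have sm: "smooth_on UNIV (\<alpha> I J)" for I J
    unfolding cov[symmetric]
    by (intro smooth_on_open_Un oX oK form_smooth[OF form] smooth_on_cong[OF oK _ smooth_on_const[of _ 0]])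
       (simp add: out)
  have outw: "wirt j (\<alpha> I J) z = 0" "wirt_bar j (\<alpha> I J) z = 0" if "z \<notin> X" for I J j z
  proof -
    have z: "z \<in> - K" using that cov by blast
    have "wirt j (\<alpha> I J) z = wirt j (\<lambda>z. 0) z" "wirt_bar j (\<alpha> I J) z = wirt_bar j (\<lambda>z. 0) z"
      by (intro wirt_cong[OF oK z] wirt_bar_cong[OF oK z]; simp add: out)+
    then show "wirt j (\<alpha> I J) z = 0" "wirt_bar j (\<alpha> I J) z = 0" by (simp_all add: wirt_zero)
  qed
  obtain M where M: "M > 0" "\<And>z. z \<in> K \<Longrightarrow> norm z < M"
    using compact_imp_bounded[OF K] unfolding bounded_pos_less by blast
  have "K \<inter> real_plane = {}" by (auto simp: K_def form_support_def X)
  then obtain d where d: "d > 0" "\<And>x y. x \<in> K \<Longrightarrow> y \<in> real_plane \<Longrightarrow> d \<le> dist x y"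
    using separate_compact_closed[OF K closed_real_plane] by blast
  define \<epsilon> where "\<epsilon> = d / 2"
  have \<epsilon>: "\<epsilon> > 0" using d by (simp add: \<epsilon>_def)
  define a where "a i j = \<alpha> {i} {j}" for i j
  have tube: "a i j z = 0" if "\<bar>Im (z $ 1)\<bar> < \<epsilon>" "\<bar>Im (z $ 2)\<bar> < \<epsilon>" for i j z
    unfolding a_def
  proof (rule out, rule notI)
    assume "z \<in> K"
    \<comment> \<open>the point of the real plane below \<open>z\<close>, at distance at most \<open>|Im z\<^sub>1| + |Im z\<^sub>2|\<close>\<close>
    define y :: "complex ^ 2" where "y = (\<chi> i. of_real (Re (z $ i)))"
    have "d \<le> dist z y" using \<open>z \<in> K\<close> by (rule d) (simp add: y_def real_plane_iff)
    also have "\<dots> \<le> (\<Sum>i\<in>UNIV. norm ((z - y) $ i))"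
      unfolding dist_norm norm_vec_def by (rule L2_set_le_sum) auto
    also have "\<dots> = \<bar>Im (z $ 1)\<bar> + \<bar>Im (z $ 2)\<bar>"
      by (simp add: sum_2 y_def cmod_def)
    also have "\<dots> < d" using that by (simp add: \<epsilon>_def)
    finally show False by simp
  qed
  obtain f where f: "smooth_on UNIV f" "\<And>z. norm (z $ 1) > M + 1 \<or> norm (z $ 2) > M + 1 \<Longrightarrow> f z = 0"
    "\<And>i j z. wirt i (wirt_bar j f) z = a i j z"
    "\<And>z. \<bar>Im (z $ 1)\<bar> < \<epsilon> \<Longrightarrow> \<bar>Im (z $ 2)\<bar> < \<epsilon> \<Longrightarrow> f z = 0"
  proof (rule ddbar_compact_support_solution[of a M \<epsilon>])
    show "a i j z = 0" if "norm (z $ 1) \<ge> M \<or> norm (z $ 2) \<ge> M" for i j z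
      unfolding a_def
    proof (rule out, rule notI)
      assume "z \<in> K"
      then show False
        using M(2)[of z] that Finite_Cartesian_Product.norm_nth_le[of z 1] Finite_Cartesian_Product.norm_nth_le[of z 2] by auto
    qed
    show "wirt_bar 2 (a i 1) z = wirt_bar 1 (a i 2) z" for i z
    proof (cases "z \<in> X")
      case True
      have "delbar X \<alpha> {i} {1,2} z = 0" by (simp add: delbar)
      then show ?thesis unfolding delbar_simps[OF True] by (simp add: a_def)
    qed (simp add: a_def outw)
    show "wirt 2 (a 1 j) z = wirt 1 (a 2 j) z" for j z
    proof (cases "z \<in> X")
      case True
      have "del X \<alpha> {1,2} {j} z = 0" by (simp add: del)
      then show ?thesis unfolding del_simps[OF True] by (simp add: a_def)
    qed (simp add: a_def outw)
  qed (use sm M tube in \<open>auto simp: a_def\<close>)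
  define F :: "2 form" where "F I J = (if I = {} \<and> J = {} then f else (\<lambda>z. 0))" for I J
  have fX: "f z = 0" if "z \<notin> X" for z
    using that \<epsilon> by (intro f(4)) (auto simp: X real_plane_iff)
  have "F \<in> forms 0 0 X"
    using fX by (auto simp: forms_def F_def smooth_on_const zero_fun_def intro: smooth_on_subset[OF f(1)])
  moreover have "compact (form_support X F)"
  proof -
    let ?S = "{z \<in> X. \<exists>I J. F I J z \<noteq> 0}"
    let ?T = "{z :: complex ^ 2. \<epsilon> \<le> \<bar>Im (z $ 1)\<bar>} \<union> {z. \<epsilon> \<le> \<bar>Im (z $ 2)\<bar>}"
    have S: "f z \<noteq> 0" if "z \<in> ?S" for z using that by (auto simp: F_def split: if_splits)
    have "closed ?T" by (intro closed_Un closed_Collect_le continuous_intros)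
    moreover have "?S \<subseteq> ?T"
    proof
      fix z assume "z \<in> ?S"
      from S[OF this] f(4)[of z] show "z \<in> ?T" by (auto simp: not_le[symmetric])
    qed
    ultimately have "closure ?S \<subseteq> ?T" by (rule closure_minimal[rotated])
    also have "?T \<subseteq> X" using \<epsilon> by (auto simp: X real_plane_iff)
    finally have eq: "form_support X F = closure ?S" by (auto simp: form_support_def)
    have "bounded ?S"
    proof (rule boundedI)
      fix z assume "z \<in> ?S"
      from S[OF this] f(2)[of z] have "norm (z $ 1) \<le> M + 1" "norm (z $ 2) \<le> M + 1"
        unfolding not_less[symmetric] by blast+
      moreover have "norm z \<le> norm (z $ 1) + norm (z $ 2)"
        unfolding norm_vec_def[of z] using L2_set_le_sum[of UNIV "\<lambda>i. norm (z $ i)"] by (simp add: sum_2)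
      ultimately show "norm z \<le> 2 * (M + 1)" by simp
    qed
    then show ?thesis unfolding eq by (simp add: compact_closure)
  qed
  ultimately have "F \<in> forms_c 0 0 X" by (simp add: forms_c_def)
  moreover have "del X (delbar X F) = \<alpha>"
  proof (intro ext)
    fix I J z
    have F0: "F I J = (\<lambda>z. 0)" if "I \<noteq> {} \<or> J \<noteq> {}" for I J
      using that by (auto simp: F_def)
    have d0: "delbar X F I J = (\<lambda>z. 0)" if "I \<noteq> {} \<or> card J \<noteq> 1" for I J
    proof
      fix z show "delbar X F I J z = 0"
      proof (cases "z \<in> X")
        case True
        then show ?thesis
          using that by (cases J rule: set2_cases) (auto simp: delbar_simps F0 wirt_zero)
      qed (simp add: delbar_def)
    qed
    have d1: "delbar X F {} {j} z = wirt_bar j f z" if "z \<in> X" for j z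
      using that by (simp add: delbar_simps F_def)
    show "del X (delbar X F) I J z = \<alpha> I J z"
    proof (cases "z \<in> X \<and> card I = 1 \<and> card J = 1")
      case True
      then obtain i j where ij: "I = {i}" "J = {j}" using card_1_singletonE by metis
      have "wirt i (delbar X F {} {j}) z = wirt i (wirt_bar j f) z"
        by (rule wirt_cong[OF oX]) (use True d1 in auto)
      then show ?thesis using True by (simp add: ij del_simps f(3) a_def)
    next
      case False
      then have "\<alpha> I J z = 0" using form by (auto simp: forms_def zero_fun_def)
      moreover have "del X (delbar X F) I J z = 0"
      proof (cases "z \<in> X")
        case True
        then have "card I \<noteq> 1 \<or> card J \<noteq> 1" using False by blast
        with True show ?thesis
          by (cases I rule: set2_cases) (auto simp: del_simps d0 wirt_zero)
      qed (simp add: del_def)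
      ultimately show ?thesis by simp
    qed
  qed
  ultimately show ?thesis unfolding BC_coboundaries_c_def by force
qed

lemma H11_BC_c_trivial: "H11_BC_c (UNIV - real_plane) = {0 +o BC_coboundaries_c (UNIV - real_plane)}"
proof -
  let ?X = "UNIV - real_plane :: (complex^2) set"
  let ?B = "BC_coboundaries_c ?X"
  have oX: "open ?X" using closed_real_plane by (simp add: open_Diff)
  have Z0: "0 \<in> BC_cocycles_c ?X"
    using zero_in_forms[of 1 1 ?X]
    by (auto simp: BC_cocycles_c_def forms_c_def form_support_def del_zero delbar_zero)
  have diff: "\<beta> - \<gamma> \<in> ?B" if "\<beta> \<in> ?B" "\<gamma> \<in> ?B" for \<beta> \<gamma>
    using BC_coboundaries_c_diff[OF oX that] .
  have B0: "0 \<in> ?B" using BC_cocycle_is_coboundary[OF refl Z0] .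
  have "\<alpha> +o ?B = 0 +o ?B" if "\<alpha> \<in> BC_cocycles_c ?X" for \<alpha>
  proof -
    have \<alpha>: "\<alpha> \<in> ?B" by (rule BC_cocycle_is_coboundary[OF refl that])
    have "\<alpha> + \<beta> \<in> ?B" if "\<beta> \<in> ?B" for \<beta>
      using diff[OF \<alpha> diff[OF B0 that]] by simp
    moreover have "\<exists>\<gamma>\<in>?B. \<beta> = \<alpha> + \<gamma>" if "\<beta> \<in> ?B" for \<beta>
      using diff[OF that \<alpha>] by (intro bexI[of _ "\<beta> - \<alpha>"]) auto
    ultimately show ?thesis by (auto simp: elt_set_plus_def)
  qed
  then show ?thesis unfolding H11_BC_c_def quot_def using Z0 by blast
qed

theorem mainTheorem4:
  fixes X :: "(complex ^ 2) set"
  assumes "X = UNIV - real_plane"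
  shows "H11_BC_c X = {0 +o BC_coboundaries_c X} \<and> H11_A X \<noteq> {0 +o A_coboundaries X}"
  using H11_BC_c_trivial H11_A_nonzero assms by simp

end
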